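(* Let $\Gamma$ be a finite group. If a $\mathbb{Z}\Gamma$-module $M$ has a permutation presentation, then the group cohomology $H^1(\Gamma,M)$ is annihilated by $\exp(\Gamma)$.
   Context: All modules are left modules and are not assumed finitely generated. The exponent $\exp(\Gamma)$ is the smallest positive integer $n$ with $\gamma^n=1$ for all $\gamma\in\Gamma$. A $\mathbb{Z}\Gamma$-module $F$ is a permutation module if it has a basis as a $\mathbb{Z}$-module which is permuted by the action of $\Gamma$. A permutation presentation of a $\mathbb{Z}\Gamma$-module $M$ is an exact sequence $0\to F\to F\to M\to 0$ of $\mathbb{Z}\Gamma$-modules where $F$ is a permutation $\mathbb{Z}\Gamma$-module (the same $F$ in both places). *)

theory Defs
  imports "HOL-Algebra.Coset" "HOL-Algebra.Module"
begin

section \<open>The integral group ring\<close>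

definition group_ring_supp :: "('g \<Rightarrow> int) \<Rightarrow> 'g set"
  where "group_ring_supp a = {x. a x \<noteq> 0}"

text \<open>Elements are the finitely supported integer-valued functions on the group (extended by 0
  outside the carrier); multiplication is convolution.\<close>

definition int_group_ring :: "('g, 'r) monoid_scheme \<Rightarrow> ('g \<Rightarrow> int) ring"
  where "int_group_ring G =
    \<lparr>carrier = {a. finite (group_ring_supp a) \<and> group_ring_supp a \<subseteq> carrier G},
     mult = (\<lambda>a b x. \<Sum>(y, z) \<in> {(y, z) \<in> group_ring_supp a \<times> group_ring_supp b. y \<otimes>\<^bsub>G\<^esub> z = x}. a y * b z),
     one = (\<lambda>x. if x = \<one>\<^bsub>G\<^esub> then 1 else 0),
     zero = (\<lambda>x. 0),
     add = (\<lambda>a b x. a x + b x)\<rparr>"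

definition group_ring_of :: "'g \<Rightarrow> 'g \<Rightarrow> int"
  where "group_ring_of g = (\<lambda>x. if x = g then 1 else 0)"

lemma group_ring_mult_eq:
  assumes "finite A" "finite B" "group_ring_supp a \<subseteq> A" "group_ring_supp b \<subseteq> B"
  shows "(a \<otimes>\<^bsub>int_group_ring G\<^esub> b) x = (\<Sum>y\<in>A. \<Sum>z\<in>B. if y \<otimes>\<^bsub>G\<^esub> z = x then a y * b z else 0)"
proof -
  have "(\<Sum>y\<in>A. \<Sum>z\<in>B. if y \<otimes>\<^bsub>G\<^esub> z = x then a y * b z else 0)
      = (\<Sum>(y, z)\<in>A \<times> B. if y \<otimes>\<^bsub>G\<^esub> z = x then a y * b z else 0)"
    by (simp add: sum.cartesian_product)
  also have "\<dots> = (\<Sum>(y, z) \<in> {(y, z) \<in> group_ring_supp a \<times> group_ring_supp b. y \<otimes>\<^bsub>G\<^esub> z = x}. a y * b z)"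
    using assms by (intro sum.mono_neutral_cong_right) (auto simp: group_ring_supp_def split: if_splits)
  finally show ?thesis by (simp add: int_group_ring_def)
qed

lemma group_ring_supp_mult:
  "group_ring_supp (a \<otimes>\<^bsub>int_group_ring G\<^esub> b)
    \<subseteq> (\<lambda>(y, z). y \<otimes>\<^bsub>G\<^esub> z) ` (group_ring_supp a \<times> group_ring_supp b)"
proof
  fix x assume "x \<in> group_ring_supp (a \<otimes>\<^bsub>int_group_ring G\<^esub> b)"
  hence "(\<Sum>(y, z) \<in> {(y, z) \<in> group_ring_supp a \<times> group_ring_supp b. y \<otimes>\<^bsub>G\<^esub> z = x}. a y * b z) \<noteq> 0"
    by (simp add: group_ring_supp_def int_group_ring_def)
  hence "{(y, z) \<in> group_ring_supp a \<times> group_ring_supp b. y \<otimes>\<^bsub>G\<^esub> z = x} \<noteq> {}"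
    by (metis (lifting) sum.empty)
  thus "x \<in> (\<lambda>(y, z). y \<otimes>\<^bsub>G\<^esub> z) ` (group_ring_supp a \<times> group_ring_supp b)"
    by auto
qed

lemma group_ring_supp_add:
  "group_ring_supp (a \<oplus>\<^bsub>int_group_ring G\<^esub> b) \<subseteq> group_ring_supp a \<union> group_ring_supp b"
  by (auto simp: group_ring_supp_def int_group_ring_def)

lemma (in group) group_ring_assoc:
  assumes a: "a \<in> carrier (int_group_ring G)" and b: "b \<in> carrier (int_group_ring G)"
    and c: "c \<in> carrier (int_group_ring G)"
  shows "(a \<otimes>\<^bsub>int_group_ring G\<^esub> b) \<otimes>\<^bsub>int_group_ring G\<^esub> c
       = a \<otimes>\<^bsub>int_group_ring G\<^esub> (b \<otimes>\<^bsub>int_group_ring G\<^esub> c)"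
proof
  fix x
  let ?R = "int_group_ring G"
  define A B C where "A = group_ring_supp a" and "B = group_ring_supp b" and "C = group_ring_supp c"
  have fin: "finite A" "finite B" "finite C" and sub: "A \<subseteq> carrier G" "B \<subseteq> carrier G" "C \<subseteq> carrier G"
    using assms by (auto simp: int_group_ring_def A_def B_def C_def)
  define D where "D = (\<lambda>(y, z). y \<otimes> z) ` (A \<times> B)"
  define E where "E = (\<lambda>(y, z). y \<otimes> z) ` (B \<times> C)"
  have finD: "finite D" "finite E" using fin by (auto simp: D_def E_def)
  have sD: "group_ring_supp (a \<otimes>\<^bsub>?R\<^esub> b) \<subseteq> D" "group_ring_supp (b \<otimes>\<^bsub>?R\<^esub> c) \<subseteq> E"
    using group_ring_supp_mult[of G a b] group_ring_supp_mult[of G b c]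
    by (simp_all add: D_def E_def A_def B_def C_def)
  let ?T = "\<lambda>p q r. if p \<otimes> q \<otimes> r = x then a p * b q * c r else 0"
  have "((a \<otimes>\<^bsub>?R\<^esub> b) \<otimes>\<^bsub>?R\<^esub> c) x =
      (\<Sum>w\<in>D. \<Sum>r\<in>C. if w \<otimes> r = x then (\<Sum>p\<in>A. \<Sum>q\<in>B. if p \<otimes> q = w then a p * b q else 0) * c r else 0)"
    by (subst group_ring_mult_eq[OF finD(1) fin(3) sD(1)])
       (simp_all add: C_def[symmetric] A_def[symmetric] B_def[symmetric] group_ring_mult_eq[OF fin(1,2)] cong: if_cong)
  also have "\<dots> = (\<Sum>w\<in>D. \<Sum>r\<in>C. \<Sum>p\<in>A. \<Sum>q\<in>B. if w = p \<otimes> q then ?T p q r else 0)"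
    by (auto intro!: sum.cong sum.neutral simp: sum_distrib_right)
  also have "\<dots> = (\<Sum>r\<in>C. \<Sum>p\<in>A. \<Sum>q\<in>B. \<Sum>w\<in>D. if w = p \<otimes> q then ?T p q r else 0)"
    by (subst sum.swap, rule sum.cong[OF refl], subst sum.swap, rule sum.cong[OF refl], rule sum.swap)
  also have "\<dots> = (\<Sum>r\<in>C. \<Sum>p\<in>A. \<Sum>q\<in>B. ?T p q r)"
    using finD(1) by (intro sum.cong refl) (auto simp: D_def)
  also have "\<dots> = (\<Sum>p\<in>A. \<Sum>q\<in>B. \<Sum>r\<in>C. ?T p q r)"
    by (subst sum.swap, rule sum.cong[OF refl], rule sum.swap)
  finally have L: "((a \<otimes>\<^bsub>?R\<^esub> b) \<otimes>\<^bsub>?R\<^esub> c) x = (\<Sum>p\<in>A. \<Sum>q\<in>B. \<Sum>r\<in>C. ?T p q r)" .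
  have "(a \<otimes>\<^bsub>?R\<^esub> (b \<otimes>\<^bsub>?R\<^esub> c)) x =
      (\<Sum>p\<in>A. \<Sum>w\<in>E. if p \<otimes> w = x then a p * (\<Sum>q\<in>B. \<Sum>r\<in>C. if q \<otimes> r = w then b q * c r else 0) else 0)"
    by (subst group_ring_mult_eq[OF fin(1) finD(2) _ sD(2)])
       (simp_all add: C_def[symmetric] A_def[symmetric] B_def[symmetric] group_ring_mult_eq[OF fin(2,3)] cong: if_cong)
  also have "\<dots> = (\<Sum>p\<in>A. \<Sum>w\<in>E. \<Sum>q\<in>B. \<Sum>r\<in>C. if w = q \<otimes> r then if p \<otimes> (q \<otimes> r) = x then a p * (b q * c r) else 0 else 0)"
    by (auto intro!: sum.cong sum.neutral simp: sum_distrib_left)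
  also have "\<dots> = (\<Sum>p\<in>A. \<Sum>q\<in>B. \<Sum>r\<in>C. \<Sum>w\<in>E. if w = q \<otimes> r then if p \<otimes> (q \<otimes> r) = x then a p * (b q * c r) else 0 else 0)"
    by (rule sum.cong[OF refl], subst sum.swap, rule sum.cong[OF refl], rule sum.swap)
  also have "\<dots> = (\<Sum>p\<in>A. \<Sum>q\<in>B. \<Sum>r\<in>C. if p \<otimes> (q \<otimes> r) = x then a p * (b q * c r) else 0)"
    using finD(2) by (intro sum.cong refl) (auto simp: E_def)
  also have "\<dots> = (\<Sum>p\<in>A. \<Sum>q\<in>B. \<Sum>r\<in>C. ?T p q r)"
    using sub by (intro sum.cong refl) (auto simp: m_assoc subset_iff mult.assoc)
  finally show "((a \<otimes>\<^bsub>?R\<^esub> b) \<otimes>\<^bsub>?R\<^esub> c) x = (a \<otimes>\<^bsub>?R\<^esub> (b \<otimes>\<^bsub>?R\<^esub> c)) x"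
    using L by simp
qed

lemma (in group) ring_int_group_ring: "ring (int_group_ring G)"
proof (rule ringI)
  let ?R = "int_group_ring G"
  have carr: "a \<in> carrier ?R \<longleftrightarrow> finite (group_ring_supp a) \<and> group_ring_supp a \<subseteq> carrier G" for a
    by (simp add: int_group_ring_def)
  have add: "a \<oplus>\<^bsub>?R\<^esub> b = (\<lambda>x. a x + b x)" for a b by (simp add: int_group_ring_def)
  have zero: "\<zero>\<^bsub>?R\<^esub> = (\<lambda>x. 0)" by (simp add: int_group_ring_def)
  have one: "\<one>\<^bsub>?R\<^esub> = (\<lambda>x. if x = \<one> then 1 else 0)" by (simp add: int_group_ring_def)
  have addc: "a \<oplus>\<^bsub>?R\<^esub> b \<in> carrier ?R" if "a \<in> carrier ?R" "b \<in> carrier ?R" for a b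
    using that finite_subset[OF group_ring_supp_add[of G a b]] group_ring_supp_add[of G a b]
    by (auto simp: carr)
  show "abelian_group ?R"
  proof (rule abelian_groupI)
    fix a assume a: "a \<in> carrier ?R"
    have "group_ring_supp (\<lambda>x. - a x) = group_ring_supp a" by (simp add: group_ring_supp_def)
    hence "(\<lambda>x. - a x) \<in> carrier ?R" using a by (simp add: carr)
    thus "\<exists>y\<in>carrier ?R. y \<oplus>\<^bsub>?R\<^esub> a = \<zero>\<^bsub>?R\<^esub>" by (rule bexI[rotated]) (simp add: add zero)
  qed (use addc in \<open>auto simp: add zero carr group_ring_supp_def\<close>)
  have onesupp: "group_ring_supp \<one>\<^bsub>?R\<^esub> = {\<one>}" by (auto simp: one group_ring_supp_def)
  show "monoid ?R"
  proof (rule monoidI)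
    fix a b assume a: "a \<in> carrier ?R" and b: "b \<in> carrier ?R"
    let ?S = "(\<lambda>(y, z). y \<otimes> z) ` (group_ring_supp a \<times> group_ring_supp b)"
    have "finite ?S" "?S \<subseteq> carrier G" using a b by (auto simp: carr)
    thus "a \<otimes>\<^bsub>?R\<^esub> b \<in> carrier ?R"
      using finite_subset[OF group_ring_supp_mult[of G a b]] subset_trans[OF group_ring_supp_mult[of G a b]]
      by (simp only: carr)
  next
    show "\<one>\<^bsub>?R\<^esub> \<in> carrier ?R" by (simp add: carr onesupp)
  next
    fix a assume a: "a \<in> carrier ?R"
    let ?A = "group_ring_supp a"
    have A: "finite ?A" "?A \<subseteq> carrier G" using a by (auto simp: carr)
    have E: "(\<Sum>z\<in>?A. if z = x then a z else 0) = a x" for x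
      using A(1) by (simp add: group_ring_supp_def)
    show "\<one>\<^bsub>?R\<^esub> \<otimes>\<^bsub>?R\<^esub> a = a"
    proof
      fix x
      have "(\<one>\<^bsub>?R\<^esub> \<otimes>\<^bsub>?R\<^esub> a) x = (\<Sum>z\<in>?A. if \<one> \<otimes> z = x then a z else 0)"
        by (subst group_ring_mult_eq[of "{\<one>}" ?A]) (use A onesupp in \<open>auto simp: one intro!: sum.cong\<close>)
      also have "\<dots> = (\<Sum>z\<in>?A. if z = x then a z else 0)"
        using A(2) by (intro sum.cong refl) (auto simp: subset_iff)
      finally show "(\<one>\<^bsub>?R\<^esub> \<otimes>\<^bsub>?R\<^esub> a) x = a x" using E by simp
    qed
    show "a \<otimes>\<^bsub>?R\<^esub> \<one>\<^bsub>?R\<^esub> = a"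
    proof
      fix x
      have "(a \<otimes>\<^bsub>?R\<^esub> \<one>\<^bsub>?R\<^esub>) x = (\<Sum>z\<in>?A. if z \<otimes> \<one> = x then a z else 0)"
        by (subst group_ring_mult_eq[of ?A "{\<one>}"]) (use A onesupp in \<open>auto simp: one intro!: sum.cong\<close>)
      also have "\<dots> = (\<Sum>z\<in>?A. if z = x then a z else 0)"
        using A(2) by (intro sum.cong refl) (auto simp: subset_iff)
      finally show "(a \<otimes>\<^bsub>?R\<^esub> \<one>\<^bsub>?R\<^esub>) x = a x" using E by simp
    qed
  qed (rule group_ring_assoc)
  fix a b c assume a: "a \<in> carrier ?R" and b: "b \<in> carrier ?R" and c: "c \<in> carrier ?R"
  let ?U = "group_ring_supp a \<union> group_ring_supp b" and ?C = "group_ring_supp c"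
  have fin: "finite ?U" "finite ?C" using a b c by (auto simp: carr)
  have sub: "group_ring_supp a \<subseteq> ?U" "group_ring_supp b \<subseteq> ?U" "?C \<subseteq> ?C"
    "group_ring_supp (a \<oplus>\<^bsub>?R\<^esub> b) \<subseteq> ?U"
    using group_ring_supp_add[of G a b] by auto
  show "(a \<oplus>\<^bsub>?R\<^esub> b) \<otimes>\<^bsub>?R\<^esub> c = a \<otimes>\<^bsub>?R\<^esub> c \<oplus>\<^bsub>?R\<^esub> b \<otimes>\<^bsub>?R\<^esub> c"
  proof
    fix x
    have "((a \<oplus>\<^bsub>?R\<^esub> b) \<otimes>\<^bsub>?R\<^esub> c) x
        = (\<Sum>y\<in>?U. \<Sum>z\<in>?C. if y \<otimes> z = x then (a \<oplus>\<^bsub>?R\<^esub> b) y * c z else 0)"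
      by (rule group_ring_mult_eq[OF fin sub(4,3)])
    also have "\<dots> = (\<Sum>y\<in>?U. \<Sum>z\<in>?C. (if y \<otimes> z = x then a y * c z else 0)
                                + (if y \<otimes> z = x then b y * c z else 0))"
      by (intro sum.cong refl) (simp add: add algebra_simps)
    also have "\<dots> = (a \<otimes>\<^bsub>?R\<^esub> c) x + (b \<otimes>\<^bsub>?R\<^esub> c) x"
      by (simp only: sum.distrib group_ring_mult_eq[OF fin sub(1,3)] group_ring_mult_eq[OF fin sub(2,3)])
    finally show "((a \<oplus>\<^bsub>?R\<^esub> b) \<otimes>\<^bsub>?R\<^esub> c) x = (a \<otimes>\<^bsub>?R\<^esub> c \<oplus>\<^bsub>?R\<^esub> b \<otimes>\<^bsub>?R\<^esub> c) x"
      by (simp only: add)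
  qed
  show "c \<otimes>\<^bsub>?R\<^esub> (a \<oplus>\<^bsub>?R\<^esub> b) = c \<otimes>\<^bsub>?R\<^esub> a \<oplus>\<^bsub>?R\<^esub> c \<otimes>\<^bsub>?R\<^esub> b"
  proof
    fix x
    have "(c \<otimes>\<^bsub>?R\<^esub> (a \<oplus>\<^bsub>?R\<^esub> b)) x
        = (\<Sum>y\<in>?C. \<Sum>z\<in>?U. if y \<otimes> z = x then c y * (a \<oplus>\<^bsub>?R\<^esub> b) z else 0)"
      by (rule group_ring_mult_eq[OF fin(2,1) sub(3,4)])
    also have "\<dots> = (\<Sum>y\<in>?C. \<Sum>z\<in>?U. (if y \<otimes> z = x then c y * a z else 0)
                                + (if y \<otimes> z = x then c y * b z else 0))"
      by (intro sum.cong refl) (simp add: add algebra_simps)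
    also have "\<dots> = (c \<otimes>\<^bsub>?R\<^esub> a) x + (c \<otimes>\<^bsub>?R\<^esub> b) x"
      by (simp only: sum.distrib group_ring_mult_eq[OF fin(2,1) sub(3,1)] group_ring_mult_eq[OF fin(2,1) sub(3,2)])
    finally show "(c \<otimes>\<^bsub>?R\<^esub> (a \<oplus>\<^bsub>?R\<^esub> b)) x = (c \<otimes>\<^bsub>?R\<^esub> a \<oplus>\<^bsub>?R\<^esub> c \<otimes>\<^bsub>?R\<^esub> b) x"
      by (simp only: add)
  qed
qed


section \<open>Left modules over a (not necessarily commutative) ring\<close>

text \<open>The library locale \<open>module\<close> requires a commutative ring of scalars.
  The \<open>mult\<close> and \<open>one\<close> fields of the record \<open>M\<close> are never used.\<close>

locale left_module = R?: ring R + M?: abelian_group M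
  for R :: "('a, 'r) ring_scheme" (structure) and M :: "('a, 'm, 'k) module_scheme" (structure) +
  assumes smult_closed [simp, intro]:
      "\<lbrakk>a \<in> carrier R; x \<in> carrier M\<rbrakk> \<Longrightarrow> a \<odot>\<^bsub>M\<^esub> x \<in> carrier M"
    and smult_l_distr:
      "\<lbrakk>a \<in> carrier R; b \<in> carrier R; x \<in> carrier M\<rbrakk> \<Longrightarrow>
        (a \<oplus> b) \<odot>\<^bsub>M\<^esub> x = a \<odot>\<^bsub>M\<^esub> x \<oplus>\<^bsub>M\<^esub> b \<odot>\<^bsub>M\<^esub> x"
    and smult_r_distr:
      "\<lbrakk>a \<in> carrier R; x \<in> carrier M; y \<in> carrier M\<rbrakk> \<Longrightarrow>
        a \<odot>\<^bsub>M\<^esub> (x \<oplus>\<^bsub>M\<^esub> y) = a \<odot>\<^bsub>M\<^esub> x \<oplus>\<^bsub>M\<^esub> a \<odot>\<^bsub>M\<^esub> y"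
    and smult_assoc:
      "\<lbrakk>a \<in> carrier R; b \<in> carrier R; x \<in> carrier M\<rbrakk> \<Longrightarrow>
        (a \<otimes> b) \<odot>\<^bsub>M\<^esub> x = a \<odot>\<^bsub>M\<^esub> (b \<odot>\<^bsub>M\<^esub> x)"
    and smult_one [simp]: "x \<in> carrier M \<Longrightarrow> \<one> \<odot>\<^bsub>M\<^esub> x = x"

definition left_module_hom ::
    "('a, 'r) ring_scheme \<Rightarrow> ('a, 'm, 'k) module_scheme \<Rightarrow> ('a, 'n, 'l) module_scheme \<Rightarrow> ('m \<Rightarrow> 'n) set"
  where "left_module_hom R M N =
    {h \<in> hom (add_monoid M) (add_monoid N).
      \<forall>a\<in>carrier R. \<forall>x\<in>carrier M. h (a \<odot>\<^bsub>M\<^esub> x) = a \<odot>\<^bsub>N\<^esub> h x}"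

definition left_module_short_exact ::
    "('a, 'r) ring_scheme \<Rightarrow> ('a, 'l, 'x) module_scheme \<Rightarrow> ('l \<Rightarrow> 'm) \<Rightarrow> ('a, 'm, 'y) module_scheme
      \<Rightarrow> ('m \<Rightarrow> 'n) \<Rightarrow> ('a, 'n, 'z) module_scheme \<Rightarrow> bool"
  where "left_module_short_exact R L i M p N \<longleftrightarrow>
    left_module R L \<and> left_module R M \<and> left_module R N \<and>
    i \<in> left_module_hom R L M \<and> p \<in> left_module_hom R M N \<and>
    inj_on i (carrier L) \<and>
    i ` carrier L = kernel (add_monoid M) (add_monoid N) p \<and>
    p ` carrier M = carrier N"


section \<open>Permutation modules and permutation presentations\<close>

definition group_act :: "('g \<Rightarrow> int, 'm, 'k) module_scheme \<Rightarrow> 'g \<Rightarrow> 'm \<Rightarrow> 'm"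
  where "group_act M g x = group_ring_of g \<odot>\<^bsub>M\<^esub> x"

text \<open>A basis of an additively written abelian group as a \<open>\<int>\<close>-module: every element is a finite
  integral linear combination of elements of \<open>B\<close> with uniquely determined coefficients.
  \<open>B\<close> may be infinite.\<close>

definition is_int_basis :: "('m, 'k) ring_scheme \<Rightarrow> 'm set \<Rightarrow> bool"
  where "is_int_basis M B \<longleftrightarrow> B \<subseteq> carrier M \<and>
    (\<forall>x\<in>carrier M. \<exists>!c :: 'm \<Rightarrow> int. finite {b. c b \<noteq> 0} \<and> {b. c b \<noteq> 0} \<subseteq> B \<and>
      x = (\<Oplus>\<^bsub>M\<^esub> b \<in> {b. c b \<noteq> 0}. [c b] \<cdot>\<^bsub>M\<^esub> b))"

definition permutation_module ::
    "('g, 'r) monoid_scheme \<Rightarrow> ('g \<Rightarrow> int, 'm, 'k) module_scheme \<Rightarrow> bool"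
  where "permutation_module G F \<longleftrightarrow> left_module (int_group_ring G) F \<and>
    (\<exists>B. is_int_basis F B \<and> (\<forall>g\<in>carrier G. bij_betw (group_act F g) B B))"

definition permutation_presentation ::
    "('g, 'r) monoid_scheme \<Rightarrow> ('g \<Rightarrow> int, 'f, 'x) module_scheme \<Rightarrow> ('f \<Rightarrow> 'f) \<Rightarrow> ('f \<Rightarrow> 'm)
      \<Rightarrow> ('g \<Rightarrow> int, 'm, 'y) module_scheme \<Rightarrow> bool"
  where "permutation_presentation G F i p M \<longleftrightarrow>
    permutation_module G F \<and> left_module_short_exact (int_group_ring G) F i F p M"


section \<open>Group cohomology\<close>

text \<open>Cohomology is computed by the complex of inhomogeneous cochains: an \<open>n\<close>-cochain is a
  function from \<open>n\<close>-tuples of group elements (lists of length \<open>n\<close>) to \<open>M\<close>. The groups of cochains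
  are written multiplicatively so that the library's kernel and quotient apply.\<close>

definition group_tuples :: "('g, 'r) monoid_scheme \<Rightarrow> nat \<Rightarrow> 'g list set"
  where "group_tuples G n = {xs. length xs = n \<and> set xs \<subseteq> carrier G}"

definition cochain_group ::
    "('g, 'r) monoid_scheme \<Rightarrow> ('g \<Rightarrow> int, 'm, 'k) module_scheme \<Rightarrow> nat \<Rightarrow> ('g list \<Rightarrow> 'm) monoid"
  where "cochain_group G M n =
    \<lparr>carrier = group_tuples G n \<rightarrow>\<^sub>E carrier M,
     mult = (\<lambda>f f'. \<lambda>xs\<in>group_tuples G n. f xs \<oplus>\<^bsub>M\<^esub> f' xs),
     one = (\<lambda>xs\<in>group_tuples G n. \<zero>\<^bsub>M\<^esub>)\<rparr>"

text \<open>For \<open>xs = [g\<^sub>1, \<dots>, g\<^sub>n\<^sub>+\<^sub>1]\<close> the three summands are \<open>g\<^sub>1 f(g\<^sub>2, \<dots>, g\<^sub>n\<^sub>+\<^sub>1)\<close>, the alternating sum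
  of the \<open>f(g\<^sub>1, \<dots>, g\<^sub>j g\<^sub>j\<^sub>+\<^sub>1, \<dots>, g\<^sub>n\<^sub>+\<^sub>1)\<close> with sign \<open>(-1)\<^sup>j\<close> (where \<open>j = i + 1\<close>), and
  \<open>(-1)\<^sup>n\<^sup>+\<^sup>1 f(g\<^sub>1, \<dots>, g\<^sub>n)\<close>.\<close>

definition coboundary_map ::
    "('g, 'r) monoid_scheme \<Rightarrow> ('g \<Rightarrow> int, 'm, 'k) module_scheme \<Rightarrow> nat \<Rightarrow> ('g list \<Rightarrow> 'm) \<Rightarrow> 'g list \<Rightarrow> 'm"
  where "coboundary_map G M n f = (\<lambda>xs\<in>group_tuples G (Suc n).
    group_act M (hd xs) (f (tl xs))
    \<oplus>\<^bsub>M\<^esub> (\<Oplus>\<^bsub>M\<^esub> i\<in>{..<n}. [((- 1 :: int) ^ Suc i)] \<cdot>\<^bsub>M\<^esub>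
          (f (take i xs @ (xs ! i \<otimes>\<^bsub>G\<^esub> xs ! Suc i) # drop (i + 2) xs)))
    \<oplus>\<^bsub>M\<^esub> [((- 1 :: int) ^ Suc n)] \<cdot>\<^bsub>M\<^esub> (f (butlast xs)))"

definition cocycles ::
    "('g, 'r) monoid_scheme \<Rightarrow> ('g \<Rightarrow> int, 'm, 'k) module_scheme \<Rightarrow> nat \<Rightarrow> ('g list \<Rightarrow> 'm) set"
  where "cocycles G M n =
    kernel (cochain_group G M n) (cochain_group G M (Suc n)) (coboundary_map G M n)"

definition coboundaries ::
    "('g, 'r) monoid_scheme \<Rightarrow> ('g \<Rightarrow> int, 'm, 'k) module_scheme \<Rightarrow> nat \<Rightarrow> ('g list \<Rightarrow> 'm) set"
  where "coboundaries G M n = (case n of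
      0 \<Rightarrow> {\<one>\<^bsub>cochain_group G M 0\<^esub>}
    | Suc m \<Rightarrow> coboundary_map G M m ` carrier (cochain_group G M m))"

definition group_cohomology ::
    "('g, 'r) monoid_scheme \<Rightarrow> ('g \<Rightarrow> int, 'm, 'k) module_scheme \<Rightarrow> nat \<Rightarrow> ('g list \<Rightarrow> 'm) set monoid"
  where "group_cohomology G M n =
    (cochain_group G M n)\<lparr>carrier := cocycles G M n\<rparr> Mod coboundaries G M n"


lemma (in group) group_ring_of_closed: "g \<in> carrier G \<Longrightarrow> group_ring_of g \<in> carrier (int_group_ring G)"
proof -
  assume "g \<in> carrier G"
  moreover have "group_ring_supp (group_ring_of g) = {g}" by (auto simp: group_ring_supp_def group_ring_of_def)
  ultimately show ?thesis by (simp add: int_group_ring_def)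
qed

text \<open>In degree 1 the cocycles are exactly the crossed homomorphisms.\<close>

lemma cocycles_1_iff:
  assumes G: "group G" and M: "left_module (int_group_ring G) M"
  shows "f \<in> cocycles G M 1 \<longleftrightarrow> f \<in> group_tuples G 1 \<rightarrow>\<^sub>E carrier M \<and>
    (\<forall>g\<in>carrier G. \<forall>h\<in>carrier G. f [g \<otimes>\<^bsub>G\<^esub> h] = f [g] \<oplus>\<^bsub>M\<^esub> group_act M g (f [h]))"
proof -
  interpret G: group G by fact
  interpret M: left_module "int_group_ring G" M by fact
  have t2: "group_tuples G (Suc (Suc 0)) = {[g, h] | g h. g \<in> carrier G \<and> h \<in> carrier G}"
    by (auto simp: group_tuples_def length_Suc_conv)
  have eq: "(a \<oplus>\<^bsub>M\<^esub> ([(- 1::int)] \<cdot>\<^bsub>M\<^esub> b) \<oplus>\<^bsub>M\<^esub> c = \<zero>\<^bsub>M\<^esub>) \<longleftrightarrow> b = c \<oplus>\<^bsub>M\<^esub> a"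
    if "a \<in> carrier M" "b \<in> carrier M" "c \<in> carrier M" for a b c
  proof -
    have [simp]: "[(- 1::int)] \<cdot>\<^bsub>M\<^esub> b = \<ominus>\<^bsub>M\<^esub> b"
      using M.M.add.int_pow_neg[of b 1] that by (simp add: M.M.add.int_pow_1)
    have "a \<oplus>\<^bsub>M\<^esub> (\<ominus>\<^bsub>M\<^esub> b) \<oplus>\<^bsub>M\<^esub> c = (c \<oplus>\<^bsub>M\<^esub> a) \<ominus>\<^bsub>M\<^esub> b"
      using that by (simp add: a_minus_def M.M.a_ac)
    moreover have "d \<ominus>\<^bsub>M\<^esub> b = \<zero>\<^bsub>M\<^esub> \<longleftrightarrow> b = d" if "d \<in> carrier M" for d
    proof
      assume "d \<ominus>\<^bsub>M\<^esub> b = \<zero>\<^bsub>M\<^esub>"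
      hence "\<ominus>\<^bsub>M\<^esub> (\<ominus>\<^bsub>M\<^esub> b) = d"
        using \<open>b \<in> carrier M\<close> that by (intro M.M.minus_equality) (simp_all add: a_minus_def)
      thus "b = d" using \<open>b \<in> carrier M\<close> by simp
    qed (use that in \<open>simp add: a_minus_def M.M.r_neg\<close>)
    ultimately show ?thesis using that by simp
  qed
  show ?thesis (is "?L \<longleftrightarrow> ?c \<and> ?R")
  proof (cases ?c)
    case c: True
    have cl: "f [g] \<in> carrier M" if "g \<in> carrier G" for g
      using c that by (auto simp: group_tuples_def PiE_def Pi_def)
    have ac: "group_act M g (f [h]) \<in> carrier M" if "g \<in> carrier G" "h \<in> carrier G" for g h
      using cl that G.group_ring_of_closed by (simp add: group_act_def)
    have cb: "coboundary_map G M 1 f [g, h] =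
        group_act M g (f [h]) \<oplus>\<^bsub>M\<^esub> ([(- 1::int)] \<cdot>\<^bsub>M\<^esub> f [g \<otimes>\<^bsub>G\<^esub> h]) \<oplus>\<^bsub>M\<^esub> f [g]"
      if gh: "g \<in> carrier G" "h \<in> carrier G" for g h
    proof -
      let ?t = "\<lambda>i. [((- 1 :: int) ^ Suc i)] \<cdot>\<^bsub>M\<^esub>
          (f (take i [g, h] @ ([g, h] ! i \<otimes>\<^bsub>G\<^esub> [g, h] ! Suc i) # drop (i + 2) [g, h]))"
      have t0: "?t 0 = [(- 1::int)] \<cdot>\<^bsub>M\<^esub> f [g \<otimes>\<^bsub>G\<^esub> h]" by simp
      have "?t 0 \<in> carrier M" unfolding t0 using cl gh by (simp add: M.M.add.int_pow_closed)
      hence "(\<Oplus>\<^bsub>M\<^esub> i\<in>{..<1}. ?t i) = ?t 0"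
        using M.M.finsum_insert[of "{}" 0 ?t] by (simp del: power_Suc add: lessThan_Suc)
      moreover have "[g, h] \<in> group_tuples G (Suc 1)" using gh by (simp add: group_tuples_def)
      moreover have "[((- 1 :: int) ^ Suc 1)] \<cdot>\<^bsub>M\<^esub> (f (butlast [g, h])) = f [g]"
        using cl gh by (simp add: M.M.add.int_pow_1)
      ultimately show ?thesis unfolding coboundary_map_def restrict_apply t0 by (simp only: if_True list.sel)
    qed
    have "?L \<longleftrightarrow> (\<forall>xs\<in>group_tuples G (Suc (Suc 0)). coboundary_map G M 1 f xs = \<zero>\<^bsub>M\<^esub>)"
      using c by (auto simp: cocycles_def kernel_def cochain_group_def coboundary_map_def fun_eq_iff restrict_def)
    also have "\<dots> \<longleftrightarrow> (\<forall>g\<in>carrier G. \<forall>h\<in>carrier G. group_act M g (f [h]) \<oplus>\<^bsub>M\<^esub> ([(- 1::int)] \<cdot>\<^bsub>M\<^esub> f [g \<otimes>\<^bsub>G\<^esub> h]) \<oplus>\<^bsub>M\<^esub> f [g] = \<zero>\<^bsub>M\<^esub>)"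
      by (simp add: t2 del: One_nat_def flip: cb) blast
    also have "\<dots> \<longleftrightarrow> ?R" using eq cl ac by auto
    finally show ?thesis using c by simp
  qed (auto simp: cocycles_def kernel_def cochain_group_def)
qed

section \<open>Exponents\<close>

definition group_exponent :: "('g, 'r) monoid_scheme \<Rightarrow> nat"
  where "group_exponent G = (LEAST n. 0 < n \<and> (\<forall>x\<in>carrier G. x [^]\<^bsub>G\<^esub> n = \<one>\<^bsub>G\<^esub>))"

text \<open>For a multiplicatively written abelian group.\<close>

definition annihilated_by :: "('a, 'r) monoid_scheme \<Rightarrow> nat \<Rightarrow> bool"
  where "annihilated_by A n \<longleftrightarrow> (\<forall>x\<in>carrier A. x [^]\<^bsub>A\<^esub> n = \<one>\<^bsub>A\<^esub>)"

end

theory Submission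
  imports Defs "HOL-Algebra.Multiplicative_Group" "HOL-Number_Theory.Cong"
begin

text \<open>
  Let \<open>0 \<rightarrow> F \<rightarrow> F \<rightarrow> M \<rightarrow> 0\<close> be a permutation presentation with maps \<open>i\<close> and \<open>p\<close>. Conceptually,
  \<open>H\<^sup>1(\<Gamma>, M)\<close> embeds into \<open>H\<^sup>2(\<Gamma>, F)\<close> because \<open>H\<^sup>1(\<Gamma>, F) = 0\<close>. By Shapiro's lemma \<open>H\<^sup>2(\<Gamma>, F)\<close> is a
  direct sum, over the orbits of the basis, of groups \<open>H\<^sup>2(\<Delta>, \<int>) = Hom(\<Delta>, \<rat>/\<int>)\<close> with \<open>\<Delta>\<close> the
  stabilizer of a basis element, and such a group of homomorphisms is killed by every \<open>n\<close> with
  \<open>\<gamma>\<^sup>n = 1\<close> throughout \<open>\<Gamma>\<close>.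

  The proof below makes this explicit without forming \<open>H\<^sup>2\<close>, and replaces \<open>\<rat>/\<int>\<close> by \<open>\<int>/N\<close> where
  \<open>N\<close> is the order of \<open>\<Gamma>\<close>. Let \<open>f\<close> be a crossed homomorphism into \<open>M\<close> and \<open>y\<close> the sum of its
  values. Summing \<open>f(gh) = f(g) + g f(h)\<close> over \<open>h\<close> gives \<open>N f(g) = y - g y\<close>
  (lemma \<open>crossed_hom_sum\<close>). With lifts \<open>\<phi>(g)\<close> of \<open>f(g)\<close> and \<open>Y\<close> of \<open>y\<close> to \<open>F\<close>, exactness yields
  \<open>S(g)\<close> in \<open>F\<close> with
  \<open>N \<phi>(g) + g Y - Y = i(S(g))\<close>, and \<open>S\<close> satisfies the cocycle rule modulo \<open>N F\<close>, because the failure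
  of \<open>\<phi>\<close> to be a crossed homomorphism lies in the image of \<open>i\<close>.

  Two facts about permutation modules finish the argument.
  First, \<open>n\<close> times a cocycle modulo \<open>N F\<close> is principal modulo \<open>N F\<close>
  (\<open>mod_cocycle_times_exponent_splits\<close>): on the stabilizer of a basis element, the coordinate of such
  a cocycle is a homomorphism to \<open>\<int>/N\<close>, hence killed by \<open>n\<close>. So
  \<open>n S(g) = N e(g) + X - g X\<close>, and with \<open>W = i(X) + n Y\<close> this reads
  \<open>W - g W = N (n \<phi>(g) - i(e(g)))\<close>.
  Secondly, the factor \<open>N\<close> can be cancelled: there is \<open>U\<close> in \<open>F\<close> with
  \<open>n \<phi>(g) - i(e(g)) = U - g U\<close> (\<open>principal_divided\<close>). Applying \<open>p\<close> gives
  \<open>n f(g) = p(U) - g p(U)\<close>, a coboundary.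
\<close>

section \<open>The action on a module over the integral group ring\<close>

lemma hom_finsum:
  assumes "abelian_group A" "abelian_group C" "h \<in> hom (add_monoid A) (add_monoid C)" "f \<in> I \<rightarrow> carrier A"
  shows "h (\<Oplus>\<^bsub>A\<^esub>j\<in>I. f j) = (\<Oplus>\<^bsub>C\<^esub>j\<in>I. h (f j))"
proof -
  interpret A: abelian_group A by fact
  interpret C: abelian_group C by fact
  interpret h: group_hom "add_monoid A" "add_monoid C" h
    using assms(3) by (simp add: group_hom_def group_hom_axioms_def A.a_group C.a_group)
  have h0: "h \<zero>\<^bsub>A\<^esub> = \<zero>\<^bsub>C\<^esub>" using h.hom_one by simp
  have hadd: "h (x \<oplus>\<^bsub>A\<^esub> y) = h x \<oplus>\<^bsub>C\<^esub> h y" if "x \<in> carrier A" "y \<in> carrier A" for x y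
    using h.hom_mult that by simp
  have hcl: "h x \<in> carrier C" if "x \<in> carrier A" for x using h.hom_closed that by simp
  show ?thesis
    using assms(4) by (induction I rule: infinite_finite_induct) (auto simp: h0 hadd hcl Pi_iff)
qed

locale group_ring_module = group G + mod: left_module "int_group_ring G" M
  for G :: "('g, 'r) monoid_scheme" (structure) and M :: "('g \<Rightarrow> int, 'm, 'k) module_scheme"
begin

abbreviation act where "act \<equiv> group_act M"

lemma group_ring_of_mult:
  assumes "g \<in> carrier G" "h \<in> carrier G"
  shows "group_ring_of g \<otimes>\<^bsub>int_group_ring G\<^esub> group_ring_of h = group_ring_of (g \<otimes> h)"
proof
  fix x
  have supp: "group_ring_supp (group_ring_of k) \<subseteq> {k}" for k :: 'g
    by (auto simp: group_ring_supp_def group_ring_of_def)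
  show "(group_ring_of g \<otimes>\<^bsub>int_group_ring G\<^esub> group_ring_of h) x = group_ring_of (g \<otimes> h) x"
    by (subst group_ring_mult_eq[OF _ _ supp supp]) (auto simp: group_ring_of_def)
qed

lemma act_closed [simp]: "g \<in> carrier G \<Longrightarrow> x \<in> carrier M \<Longrightarrow> act g x \<in> carrier M"
  by (simp add: group_act_def group_ring_of_closed)

lemma act_add: "\<lbrakk>g \<in> carrier G; x \<in> carrier M; y \<in> carrier M\<rbrakk> \<Longrightarrow> act g (x \<oplus>\<^bsub>M\<^esub> y) = act g x \<oplus>\<^bsub>M\<^esub> act g y"
  by (simp add: group_act_def group_ring_of_closed mod.smult_r_distr)

lemma act_one [simp]: "x \<in> carrier M \<Longrightarrow> act \<one> x = x"
  using mod.smult_one[of x] by (simp add: group_act_def group_ring_of_def int_group_ring_def)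

lemma act_mult: "\<lbrakk>g \<in> carrier G; h \<in> carrier G; x \<in> carrier M\<rbrakk> \<Longrightarrow> act (g \<otimes> h) x = act g (act h x)"
  by (simp add: group_act_def group_ring_of_closed mod.smult_assoc flip: group_ring_of_mult)

lemma act_hom: "g \<in> carrier G \<Longrightarrow> act g \<in> hom (add_monoid M) (add_monoid M)"
  by (auto simp: hom_def act_add)

lemma act_group_hom: "g \<in> carrier G \<Longrightarrow> group_hom (add_monoid M) (add_monoid M) (act g)"
  by (simp add: group_hom_def group_hom_axioms_def mod.M.a_group act_hom)

lemma act_minus: "g \<in> carrier G \<Longrightarrow> x \<in> carrier M \<Longrightarrow> act g (\<ominus>\<^bsub>M\<^esub> x) = \<ominus>\<^bsub>M\<^esub> act g x"
  using group_hom.hom_inv[OF act_group_hom, of g x] by (simp add: a_inv_def)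

lemma act_int_mult: "g \<in> carrier G \<Longrightarrow> x \<in> carrier M \<Longrightarrow> act g ([(k::int)] \<cdot>\<^bsub>M\<^esub> x) = [k] \<cdot>\<^bsub>M\<^esub> act g x"
  using group_hom.hom_int_pow[OF act_group_hom, of g x k] by (simp add: add_pow_def)

lemma act_finsum:
  "g \<in> carrier G \<Longrightarrow> f \<in> I \<rightarrow> carrier M \<Longrightarrow> act g (\<Oplus>\<^bsub>M\<^esub>j\<in>I. f j) = (\<Oplus>\<^bsub>M\<^esub>j\<in>I. act g (f j))"
  by (rule hom_finsum[OF mod.M.abelian_group_axioms mod.M.abelian_group_axioms act_hom])

end

section \<open>Coordinates on a permutation module\<close>

text \<open>With respect to a permuted basis, an element of a permutation module becomes a finitely
  supported integer function \<open>coord x\<close> on which \<open>g\<close> acts by substituting the inverse of \<open>g\<close>. This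
  turns every identity in the module into an identity of integers, one for each basis element.\<close>

locale permutation_basis = group_ring_module G M
  for G :: "('g, 'r) monoid_scheme" (structure) and M :: "('g \<Rightarrow> int, 'm, 'k) module_scheme" +
  fixes B :: "'m set"
  assumes basis: "is_int_basis M B"
    and permuted: "g \<in> carrier G \<Longrightarrow> bij_betw (group_act M g) B B"
begin

definition fin_coeffs :: "('m \<Rightarrow> int) \<Rightarrow> bool"
  where "fin_coeffs c \<longleftrightarrow> finite {b. c b \<noteq> 0} \<and> {b. c b \<noteq> 0} \<subseteq> B"

definition comb :: "('m \<Rightarrow> int) \<Rightarrow> 'm"
  where "comb c = (\<Oplus>\<^bsub>M\<^esub>b\<in>{b. c b \<noteq> 0}. [c b] \<cdot>\<^bsub>M\<^esub> b)"

definition coord :: "'m \<Rightarrow> 'm \<Rightarrow> int"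
  where "coord x = (THE c. fin_coeffs c \<and> x = comb c)"

lemma basis_subset: "B \<subseteq> carrier M" using basis by (simp add: is_int_basis_def)

lemma basis_carrier [simp]: "b \<in> B \<Longrightarrow> b \<in> carrier M" using basis_subset by auto

lemma act_basis [simp]: "g \<in> carrier G \<Longrightarrow> b \<in> B \<Longrightarrow> act g b \<in> B"
  using permuted by (auto simp: bij_betw_def)

lemma ex1_coord: "x \<in> carrier M \<Longrightarrow> \<exists>!c. fin_coeffs c \<and> x = comb c"
  using basis by (simp add: is_int_basis_def fin_coeffs_def comb_def conj_assoc)

lemma coord: assumes "x \<in> carrier M" shows "fin_coeffs (coord x)" "comb (coord x) = x"
  using theI'[OF ex1_coord[OF assms]] by (auto simp: coord_def)

lemma zero_int_mult: "[(0::int)] \<cdot>\<^bsub>M\<^esub> x = \<zero>\<^bsub>M\<^esub>"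
  by (simp add: add_pow_def)

text \<open>The support of a sum, or of a translate, is only known to lie in some finite set;
  the combination has to be taken over that set before sums can be compared term by term.\<close>

lemma comb_superset:
  assumes "finite A" "A \<subseteq> B" "{b. c b \<noteq> 0} \<subseteq> A"
  shows "comb c = (\<Oplus>\<^bsub>M\<^esub>b\<in>A. [c b] \<cdot>\<^bsub>M\<^esub> b)"
  unfolding comb_def
  by (rule mod.M.add.finprod_mono_neutral_cong_left) (use assms in \<open>auto simp: subset_iff zero_int_mult\<close>)

lemma comb_closed: "fin_coeffs c \<Longrightarrow> comb c \<in> carrier M"
  unfolding comb_def fin_coeffs_def by (intro mod.M.finsum_closed) auto

lemma coord_comb: assumes "fin_coeffs c" shows "coord (comb c) = c"
  using ex1_coord[OF comb_closed[OF assms]] coord[OF comb_closed[OF assms]] assms by metis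

lemma coord_outside: "x \<in> carrier M \<Longrightarrow> b \<notin> B \<Longrightarrow> coord x b = 0"
  using coord(1) by (auto simp: fin_coeffs_def)

lemma finite_coord: "x \<in> carrier M \<Longrightarrow> finite {b. coord x b \<noteq> 0}"
  using coord(1) by (auto simp: fin_coeffs_def)

lemma coord_eqI:
  assumes "x \<in> carrier M" "y \<in> carrier M" "\<And>b. b \<in> B \<Longrightarrow> coord x b = coord y b"
  shows "x = y"
proof -
  have "coord x = coord y" using assms coord_outside by (metis ext)
  thus ?thesis using coord(2) assms(1,2) by metis
qed

lemma coord_add:
  assumes "x \<in> carrier M" "y \<in> carrier M"
  shows "coord (x \<oplus>\<^bsub>M\<^esub> y) b = coord x b + coord y b"
proof -
  let ?A = "{b. coord x b \<noteq> 0} \<union> {b. coord y b \<noteq> 0}"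
  let ?c = "\<lambda>b. coord x b + coord y b"
  have A: "finite ?A" "?A \<subseteq> B" using coord(1) assms by (auto simp: fin_coeffs_def)
  have fin: "fin_coeffs ?c"
    unfolding fin_coeffs_def using A(2) by (auto intro!: finite_subset[OF _ A(1)]) (metis add_0 coord_outside assms)
  have "comb ?c = (\<Oplus>\<^bsub>M\<^esub>b\<in>?A. [?c b] \<cdot>\<^bsub>M\<^esub> b)" by (rule comb_superset[OF A]) auto
  also have "\<dots> = (\<Oplus>\<^bsub>M\<^esub>b\<in>?A. [coord x b] \<cdot>\<^bsub>M\<^esub> b \<oplus>\<^bsub>M\<^esub> [coord y b] \<cdot>\<^bsub>M\<^esub> b)"
    by (rule mod.M.finsum_cong') (use A in \<open>auto simp: mod.M.add.int_pow_mult subset_iff\<close>)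
  also have "\<dots> = (\<Oplus>\<^bsub>M\<^esub>b\<in>?A. [coord x b] \<cdot>\<^bsub>M\<^esub> b) \<oplus>\<^bsub>M\<^esub> (\<Oplus>\<^bsub>M\<^esub>b\<in>?A. [coord y b] \<cdot>\<^bsub>M\<^esub> b)"
    by (rule mod.M.finsum_addf) (use A in \<open>auto simp: subset_iff\<close>)
  also have "\<dots> = comb (coord x) \<oplus>\<^bsub>M\<^esub> comb (coord y)"
    using comb_superset[OF A, of "coord x"] comb_superset[OF A, of "coord y"] by simp
  finally have "comb ?c = x \<oplus>\<^bsub>M\<^esub> y" using coord(2) assms by simp
  thus ?thesis using coord_comb[OF fin] by simp
qed

lemma coord_zero [simp]: "coord \<zero>\<^bsub>M\<^esub> b = 0"
  using coord_add[of "\<zero>\<^bsub>M\<^esub>" "\<zero>\<^bsub>M\<^esub>" b] by simp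

lemma coord_neg: "x \<in> carrier M \<Longrightarrow> coord (\<ominus>\<^bsub>M\<^esub> x) b = - coord x b"
  using coord_add[of x "\<ominus>\<^bsub>M\<^esub> x" b] by (simp add: mod.M.r_neg)

lemma coord_diff: "x \<in> carrier M \<Longrightarrow> y \<in> carrier M \<Longrightarrow> coord (x \<ominus>\<^bsub>M\<^esub> y) b = coord x b - coord y b"
  by (simp add: a_minus_def coord_add coord_neg)

lemma coord_int_mult:
  assumes "x \<in> carrier M" shows "coord ([(k::int)] \<cdot>\<^bsub>M\<^esub> x) b = k * coord x b"
proof (induction k rule: int_induct[where k = 0])
  case base thus ?case by (simp add: add_pow_def)
next
  case (step1 k) thus ?case using assms by (simp add: mod.M.add.int_pow_mult coord_add algebra_simps)
next
  case (step2 k) thus ?case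
    using assms mod.M.add.int_pow_diff[of x k 1] by (simp add: coord_add coord_neg algebra_simps)
qed

text \<open>The group element \<open>g\<close> moves the basis element \<open>b\<close> with its coefficient to \<open>g b\<close>, so that the new
  coefficient at \<open>b\<close> is the old one at the preimage of \<open>b\<close>.\<close>

lemma coord_act:
  assumes g: "g \<in> carrier G" and x: "x \<in> carrier M" and b: "b \<in> B"
  shows "coord (act g x) b = coord x (act (inv g) b)"
proof -
  let ?A = "{b. coord x b \<noteq> 0}"
  let ?c = "\<lambda>b. if b \<in> B then coord x (act (inv g) b) else 0"
  have A: "finite ?A" "?A \<subseteq> B" using coord(1)[OF x] by (auto simp: fin_coeffs_def)
  have inj: "inj_on (act g) ?A" using permuted[OF g] A(2) by (auto simp: bij_betw_def intro: inj_on_subset)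
  have inv1: "act (inv g) (act g b) = b" "act g (act (inv g) b) = b" if "b \<in> B" for b
    using that g by (simp_all flip: act_mult)
  have supp: "{b. ?c b \<noteq> 0} \<subseteq> act g ` ?A"
  proof
    fix b assume "b \<in> {b. ?c b \<noteq> 0}"
    hence "b \<in> B" "act (inv g) b \<in> ?A" by (auto split: if_splits)
    thus "b \<in> act g ` ?A" using inv1(2)[of b] by (metis imageI)
  qed
  have gA: "finite (act g ` ?A)" "act g ` ?A \<subseteq> B" using A g by auto
  have fin: "fin_coeffs ?c"
    using finite_subset[OF supp gA(1)] subset_trans[OF supp gA(2)] by (simp add: fin_coeffs_def)
  have "act g x = act g (\<Oplus>\<^bsub>M\<^esub>b\<in>?A. [coord x b] \<cdot>\<^bsub>M\<^esub> b)"
    using coord(2)[OF x] by (simp add: comb_def)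
  also have "\<dots> = (\<Oplus>\<^bsub>M\<^esub>b\<in>?A. act g ([coord x b] \<cdot>\<^bsub>M\<^esub> b))"
    by (rule act_finsum[OF g]) (use A in auto)
  also have "\<dots> = (\<Oplus>\<^bsub>M\<^esub>b\<in>?A. [?c (act g b)] \<cdot>\<^bsub>M\<^esub> act g b)"
    by (rule mod.M.finsum_cong') (use A g in \<open>auto simp: act_int_mult inv1 subset_iff\<close>)
  also have "\<dots> = (\<Oplus>\<^bsub>M\<^esub>b\<in>act g ` ?A. [?c b] \<cdot>\<^bsub>M\<^esub> b)"
    by (rule mod.M.finsum_reindex[symmetric, OF _ inj]) (use gA in \<open>auto simp: subset_iff\<close>)
  also have "\<dots> = comb ?c" by (rule comb_superset[symmetric, OF gA supp])
  finally show ?thesis using coord_comb[OF fin] b by simp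
qed

lemma ex_coord:
  assumes "finite {b \<in> B. c b \<noteq> 0}"
  shows "\<exists>x\<in>carrier M. \<forall>b\<in>B. coord x b = c b"
proof -
  let ?c = "\<lambda>b. if b \<in> B then c b else 0"
  have "{b. ?c b \<noteq> 0} = {b \<in> B. c b \<noteq> 0}" by auto
  hence fin: "fin_coeffs ?c" using assms by (simp add: fin_coeffs_def)
  show ?thesis
    by (rule bexI[OF _ comb_closed[OF fin]]) (simp add: coord_comb[OF fin])
qed

lemmas coord_simps = coord_add coord_neg coord_diff coord_int_mult coord_act

end

section \<open>Cocycles of a permutation module modulo an integer\<close>

text \<open>The family \<open>u\<close> is a crossed homomorphism into the functions \<open>B \<rightarrow> \<int>/N\<close>. On the stabilizer of
  a point \<open>b\<close> the function \<open>\<lambda>s. u s b\<close> is a homomorphism to \<open>\<int>/N\<close>, so \<open>n u\<close> vanishes there. Hence if a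
  representative \<open>r\<close> is fixed in each orbit, the value of \<open>n u g b\<close> is the same for all \<open>g\<close> that take
  \<open>r\<close> to \<open>b\<close>. Choosing one such \<open>g\<close>, called \<open>t b\<close>, the function \<open>b \<mapsto> n u (t b) b\<close> is a potential
  for \<open>n u\<close>. The conclusion exhibits this potential rather than asserting that one exists, because its
  shape shows that its support is finite when the group is finite and each \<open>u g\<close> has finite support.\<close>

lemma (in group) mod_cocycle_times_exponent:
  fixes a :: "'a \<Rightarrow> 'c \<Rightarrow> 'c" and u :: "'a \<Rightarrow> 'c \<Rightarrow> int"
  assumes act_closed: "\<And>g b. \<lbrakk>g \<in> carrier G; b \<in> B\<rbrakk> \<Longrightarrow> a g b \<in> B"
    and act_one: "\<And>b. b \<in> B \<Longrightarrow> a \<one> b = b"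
    and act_mult: "\<And>g h b. \<lbrakk>g \<in> carrier G; h \<in> carrier G; b \<in> B\<rbrakk> \<Longrightarrow> a (g \<otimes> h) b = a g (a h b)"
    and exponent: "\<And>g. g \<in> carrier G \<Longrightarrow> g [^] n = \<one>"
    and cocycle: "\<And>g h b. \<lbrakk>g \<in> carrier G; h \<in> carrier G; b \<in> B\<rbrakk> \<Longrightarrow>
      [u (g \<otimes> h) b = u g b + u h (a (inv g) b)] (mod N)"
  obtains t where "\<And>b. b \<in> B \<Longrightarrow> t b \<in> carrier G"
    and "\<And>g b. \<lbrakk>g \<in> carrier G; b \<in> B\<rbrakk> \<Longrightarrow>
      [int n * u g b = int n * u (t b) b - int n * u (t (a (inv g) b)) (a (inv g) b)] (mod N)"
proof -
  have inv_act: "a (inv g) c = b" if "g \<in> carrier G" "b \<in> B" "a g b = c" for g b c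
    using act_mult[of "inv g" g b] that act_one by simp
  have stab: "[int n * u s b = 0] (mod N)" if s: "s \<in> carrier G" "b \<in> B" "a s b = b" for s b
  proof -
    have si: "a (inv s) b = b" using inv_act[OF s] .
    have u1: "[u \<one> b = 0] (mod N)"
      using cocycle[of \<one> \<one> b] s act_one
      by (simp add: cong_iff_dvd_diff)
    have "[u (s [^] (m::nat)) b = int m * u s b] (mod N)" for m
    proof (induction m)
      case 0 thus ?case using u1 by simp
    next
      case (Suc m)
      have "[u (s \<otimes> s [^] m) b = u s b + u (s [^] m) b] (mod N)"
        using cocycle[of s "s [^] m" b] s si by simp
      also have "[u s b + u (s [^] m) b = u s b + int m * u s b] (mod N)"
        by (rule cong_add[OF cong_refl Suc.IH])
      finally show ?case using s(1) nat_pow_Suc2[OF s(1), of m] by (simp add: algebra_simps)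
    qed
    from this[of n] u1 show ?thesis using exponent[OF s(1)] by (metis cong_sym cong_trans)
  qed
  \<comment> \<open>The representative depends on the orbit alone, as a set, so it is constant along the orbit.\<close>
  define orb where "orb b = (\<lambda>g. a g b) ` carrier G" for b
  define r where "r b = (SOME c. c \<in> orb b)" for b
  define t where "t b = (SOME g. g \<in> carrier G \<and> a g (r b) = b)" for b
  have orb_act: "orb (a g b) = orb b" if g: "g \<in> carrier G" "b \<in> B" for g b
  proof -
    have sub: "orb (a h c) \<subseteq> orb c" if "h \<in> carrier G" "c \<in> B" for h c
    proof
      fix d assume "d \<in> orb (a h c)"
      then obtain k where k: "k \<in> carrier G" "d = a k (a h c)" by (auto simp: orb_def)
      hence "d = a (k \<otimes> h) c" using that act_mult by simp
      thus "d \<in> orb c" using that k by (auto simp: orb_def)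
    qed
    from sub[OF g] sub[of "inv g" "a g b"] inv_act[OF g refl] act_closed[OF g] g show ?thesis by auto
  qed
  have r: "r b \<in> orb b" if "b \<in> B" for b
    unfolding r_def by (rule someI[of _ "a \<one> b"]) (auto simp: orb_def)
  have rB: "r b \<in> B" if "b \<in> B" for b using r[OF that] that act_closed by (auto simp: orb_def)
  have t: "t b \<in> carrier G \<and> a (t b) (r b) = b" if b: "b \<in> B" for b
  proof -
    obtain g where g: "g \<in> carrier G" "r b = a g b" using r[OF b] by (auto simp: orb_def)
    have "inv g \<in> carrier G \<and> a (inv g) (r b) = b" using g inv_act[OF g(1) b] by simp
    thus ?thesis unfolding t_def by (rule someI)
  qed
  show thesis
  proof (rule that[of t])
    show "t b \<in> carrier G" if "b \<in> B" for b using t[OF that] by simp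
    fix g b assume g: "g \<in> carrier G" and b: "b \<in> B"
    define c where "c = a (inv g) b"
    have c: "c \<in> B" using act_closed g b by (simp add: c_def)
    have gc: "a g c = b" using act_mult[of g "inv g" b] g b act_one by (simp add: c_def)
    have rc: "r c = r b" using orb_act[of "inv g" b] g b by (simp add: r_def c_def)
    \<comment> \<open>Both \<open>t b\<close> and \<open>g \<otimes> t c\<close> take the representative to \<open>b\<close>; they differ by \<open>s\<close> in its stabilizer.
      Expanding \<open>u (g \<otimes> t c) b = u (t b \<otimes> s) b\<close> in two ways gives the claim.\<close>
    define s where "s = inv (t b) \<otimes> (g \<otimes> t c)"
    have s: "s \<in> carrier G" using t b c g by (simp add: s_def)
    have ts: "t b \<otimes> s = g \<otimes> t c" using t b c g by (simp add: s_def m_assoc[symmetric])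
    have ra: "a (inv (t b)) b = r b" using inv_act[of "t b" "r b" b] t b rB by simp
    have "a (g \<otimes> t c) (r b) = b" using t[OF c] t[OF b] gc rc g rB[OF b] act_mult by metis
    hence "a s (r b) = r b"
      unfolding s_def using act_mult[of "inv (t b)" "g \<otimes> t c" "r b"] ra t b c g rB by simp
    hence st: "[int n * u s (r b) = 0] (mod N)" using stab s rB b by blast
    have "[u g b + u (t c) c = u (g \<otimes> t c) b] (mod N)"
      using cocycle[of g "t c" b] t c g b by (simp add: c_def cong_sym)
    also have "[u (g \<otimes> t c) b = u (t b) b + u s (r b)] (mod N)"
      using cocycle[of "t b" s b] t b s ra ts by simp
    finally have "[int n * (u g b + u (t c) c) = int n * (u (t b) b + u s (r b))] (mod N)"
      by (rule cong_mult[OF cong_refl])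
    moreover have "[int n * u (t b) b + int n * u s (r b) = int n * u (t b) b + 0] (mod N)"
      by (rule cong_add[OF cong_refl st])
    ultimately have "[int n * u g b + int n * u (t c) c = int n * u (t b) b] (mod N)"
      by (metis cong_trans distrib_left add_0_right)
    from cong_diff[OF this cong_refl[of "int n * u (t c) c"]]
    show "[int n * u g b = int n * u (t b) b - int n * u (t (a (inv g) b)) (a (inv g) b)] (mod N)"
      by (simp add: c_def)
  qed
qed

context permutation_basis begin

text \<open>In cohomological terms, \<open>n\<close> annihilates the first cohomology of \<open>M/NM\<close>. The finiteness of the
  group bounds the support of the potential, which therefore is a module element.\<close>

lemma mod_cocycle_times_exponent_splits:
  fixes N :: int
  assumes fin: "finite (carrier G)" and "N \<noteq> 0"
    and exponent: "\<And>g. g \<in> carrier G \<Longrightarrow> g [^] n = \<one>"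
    and S: "\<And>g. g \<in> carrier G \<Longrightarrow> S g \<in> carrier M"
    and cocycle: "\<And>g h. \<lbrakk>g \<in> carrier G; h \<in> carrier G\<rbrakk> \<Longrightarrow>
      \<exists>c\<in>carrier M. S (g \<otimes> h) = S g \<oplus>\<^bsub>M\<^esub> act g (S h) \<oplus>\<^bsub>M\<^esub> [N] \<cdot>\<^bsub>M\<^esub> c"
  obtains X where "X \<in> carrier M"
    "\<And>g. g \<in> carrier G \<Longrightarrow> \<exists>e\<in>carrier M. [int n] \<cdot>\<^bsub>M\<^esub> S g = [N] \<cdot>\<^bsub>M\<^esub> e \<oplus>\<^bsub>M\<^esub> (X \<ominus>\<^bsub>M\<^esub> act g X)"
proof -
  have mod_cocycle: "[coord (S (g \<otimes> h)) b = coord (S g) b + coord (S h) (act (inv g) b)] (mod N)"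
    if gh: "g \<in> carrier G" "h \<in> carrier G" and b: "b \<in> B" for g h b
  proof -
    obtain c where "c \<in> carrier M" "S (g \<otimes> h) = S g \<oplus>\<^bsub>M\<^esub> act g (S h) \<oplus>\<^bsub>M\<^esub> [N] \<cdot>\<^bsub>M\<^esub> c"
      using cocycle gh by blast
    thus ?thesis using gh b S by (simp add: coord_simps cong_iff_dvd_diff)
  qed
  obtain t where t: "\<And>b. b \<in> B \<Longrightarrow> t b \<in> carrier G"
    and spl: "\<And>g b. \<lbrakk>g \<in> carrier G; b \<in> B\<rbrakk> \<Longrightarrow> [int n * coord (S g) b
      = int n * coord (S (t b)) b - int n * coord (S (t (act (inv g) b))) (act (inv g) b)] (mod N)"
    by (rule mod_cocycle_times_exponent[of B act n "\<lambda>g. coord (S g)" N])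
      (use exponent mod_cocycle in \<open>auto simp: act_mult\<close>)
  have "finite (\<Union>g\<in>carrier G. {b. coord (S g) b \<noteq> 0})" using fin finite_coord S by blast
  hence "finite {b \<in> B. int n * coord (S (t b)) b \<noteq> 0}" by (rule finite_subset[rotated]) (use t in auto)
  from ex_coord[OF this] obtain X where X: "X \<in> carrier M" "\<And>b. b \<in> B \<Longrightarrow> coord X b = int n * coord (S (t b)) b"
    by blast
  show thesis
  proof (rule that[OF X(1)])
    fix g assume g: "g \<in> carrier G"
    define D where "D = [int n] \<cdot>\<^bsub>M\<^esub> S g \<ominus>\<^bsub>M\<^esub> (X \<ominus>\<^bsub>M\<^esub> act g X)"
    have D: "D \<in> carrier M" using g S X by (simp add: D_def)
    have dvd: "N dvd coord D b" if "b \<in> B" for b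
      using spl[OF g that] g S X that by (simp add: D_def coord_simps cong_iff_dvd_diff)
    have "finite {b \<in> B. coord D b div N \<noteq> 0}"
      by (rule finite_subset[OF _ finite_coord[OF D]]) auto
    from ex_coord[OF this] obtain e where e: "e \<in> carrier M" "\<And>b. b \<in> B \<Longrightarrow> coord e b = coord D b div N"
      by blast
    have "[int n] \<cdot>\<^bsub>M\<^esub> S g = [N] \<cdot>\<^bsub>M\<^esub> e \<oplus>\<^bsub>M\<^esub> (X \<ominus>\<^bsub>M\<^esub> act g X)"
    proof (rule coord_eqI)
      fix b assume b: "b \<in> B"
      have "N * coord e b = coord D b" using dvd e b by simp
      thus "coord ([int n] \<cdot>\<^bsub>M\<^esub> S g) b = coord ([N] \<cdot>\<^bsub>M\<^esub> e \<oplus>\<^bsub>M\<^esub> (X \<ominus>\<^bsub>M\<^esub> act g X)) b"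
        using g S X(1) e(1) b by (simp add: D_def coord_simps)
    qed (use g S X e in auto)
    thus "\<exists>e\<in>carrier M. [int n] \<cdot>\<^bsub>M\<^esub> S g = [N] \<cdot>\<^bsub>M\<^esub> e \<oplus>\<^bsub>M\<^esub> (X \<ominus>\<^bsub>M\<^esub> act g X)" using e(1) by blast
  qed
qed

text \<open>Every invariant element of \<open>M/NM\<close> lifts to an invariant element of \<open>M\<close>, namely to the one
  whose coordinates are the residues in a fixed system modulo \<open>N\<close>. Here \<open>W\<close> is invariant modulo \<open>N\<close>;
  subtracting the lift \<open>W mod N\<close> leaves \<open>N\<close> times the coordinatewise quotient \<open>U = W div N\<close>.\<close>

lemma principal_divided:
  fixes N :: int
  assumes N: "N \<noteq> 0" and W: "W \<in> carrier M"
    and d: "\<And>g. g \<in> carrier G \<Longrightarrow> d g \<in> carrier M \<and> W \<ominus>\<^bsub>M\<^esub> act g W = [N] \<cdot>\<^bsub>M\<^esub> d g"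
  obtains U where "U \<in> carrier M" "\<And>g. g \<in> carrier G \<Longrightarrow> d g = U \<ominus>\<^bsub>M\<^esub> act g U"
proof -
  have "finite {b \<in> B. coord W b div N \<noteq> 0}"
    by (rule finite_subset[OF _ finite_coord[OF W]]) auto
  from ex_coord[OF this] obtain U where U: "U \<in> carrier M" "\<And>b. b \<in> B \<Longrightarrow> coord U b = coord W b div N"
    by blast
  show thesis
  proof (rule that[OF U(1)])
    fix g assume g: "g \<in> carrier G"
    show "d g = U \<ominus>\<^bsub>M\<^esub> act g U"
    proof (rule coord_eqI)
      fix b assume b: "b \<in> B"
      have "coord (W \<ominus>\<^bsub>M\<^esub> act g W) b = coord ([N] \<cdot>\<^bsub>M\<^esub> d g) b" using d[OF g] by simp
      hence "coord W b = coord W (act (inv g) b) + N * coord (d g) b"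
        using g W d[OF g, THEN conjunct1] b by (simp add: coord_simps algebra_simps)
      hence "coord W b div N = coord W (act (inv g) b) div N + coord (d g) b" using N by simp
      thus "coord (d g) b = coord (U \<ominus>\<^bsub>M\<^esub> act g U) b" using g U b by (simp add: coord_simps)
    qed (use g U d in auto)
  qed
qed

end

section \<open>The first cohomology group by crossed homomorphisms\<close>

context group_ring_module begin

lemma cochain_comm_group: "comm_group (cochain_group G M n)"
proof (rule comm_groupI)
  let ?C = "cochain_group G M n"
  fix f assume f: "f \<in> carrier ?C"
  let ?f = "\<lambda>xs\<in>group_tuples G n. \<ominus>\<^bsub>M\<^esub> f xs"
  have "?f \<in> carrier ?C" "?f \<otimes>\<^bsub>?C\<^esub> f = \<one>\<^bsub>?C\<^esub>"
    using f by (auto simp: cochain_group_def PiE_iff fun_eq_iff mod.M.l_neg)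
  thus "\<exists>f'\<in>carrier ?C. f' \<otimes>\<^bsub>?C\<^esub> f = \<one>\<^bsub>?C\<^esub>" by blast
qed (auto simp: cochain_group_def PiE_iff fun_eq_iff extensional_def mod.M.a_ac)

lemma coboundary_map_hom:
  "coboundary_map G M n \<in> hom (cochain_group G M n) (cochain_group G M (Suc n))"
proof -
  let ?con = "\<lambda>i xs. take i xs @ (xs ! i \<otimes> xs ! Suc i) # drop (Suc (Suc i)) xs"
  have tup: "hd xs \<in> carrier G" "tl xs \<in> group_tuples G n" "butlast xs \<in> group_tuples G n"
    "i < n \<Longrightarrow> ?con i xs \<in> group_tuples G n" if "xs \<in> group_tuples G (Suc n)" for xs i
    using that
    by (auto simp: group_tuples_def length_Suc_conv subset_iff nth_Cons' dest: in_set_butlastD in_set_takeD in_set_dropD)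
  show ?thesis
  proof (rule homI)
    fix f assume "f \<in> carrier (cochain_group G M n)"
    hence f: "f xs \<in> carrier M" if "xs \<in> group_tuples G n" for xs
      using that by (auto simp: cochain_group_def)
    show "coboundary_map G M n f \<in> carrier (cochain_group G M (Suc n))"
      unfolding coboundary_map_def cochain_group_def partial_object.simps restrict_PiE_iff
      using f tup by (intro ballI mod.M.a_closed mod.M.finsum_closed) (auto simp: Pi_iff simp del: power_Suc)
  next
    fix f f' assume "f \<in> carrier (cochain_group G M n)" "f' \<in> carrier (cochain_group G M n)"
    hence f: "f xs \<in> carrier M" "f' xs \<in> carrier M" if "xs \<in> group_tuples G n" for xs
      using that by (auto simp: cochain_group_def)
    let ?s = "\<lambda>f xs i. [((- 1 :: int) ^ Suc i)] \<cdot>\<^bsub>M\<^esub> f (?con i xs)"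
    show "coboundary_map G M n (f \<otimes>\<^bsub>cochain_group G M n\<^esub> f')
      = coboundary_map G M n f \<otimes>\<^bsub>cochain_group G M (Suc n)\<^esub> coboundary_map G M n f'"
    proof
      fix xs
      show "coboundary_map G M n (f \<otimes>\<^bsub>cochain_group G M n\<^esub> f') xs
        = (coboundary_map G M n f \<otimes>\<^bsub>cochain_group G M (Suc n)\<^esub> coboundary_map G M n f') xs"
      proof (cases "xs \<in> group_tuples G (Suc n)")
        case True
        note t = tup[OF True]
        have cl: "?s f xs \<in> {..<n} \<rightarrow> carrier M" "?s f' xs \<in> {..<n} \<rightarrow> carrier M"
          using f t(4) by auto
        have "(\<Oplus>\<^bsub>M\<^esub>i\<in>{..<n}. ?s (f \<otimes>\<^bsub>cochain_group G M n\<^esub> f') xs i)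
          = (\<Oplus>\<^bsub>M\<^esub>i\<in>{..<n}. ?s f xs i \<oplus>\<^bsub>M\<^esub> ?s f' xs i)"
          by (rule mod.M.finsum_cong')
            (use cl f t(4) in \<open>auto simp: cochain_group_def mod.M.add.int_pow_distrib simp del: power_Suc\<close>)
        also have "\<dots> = (\<Oplus>\<^bsub>M\<^esub>i\<in>{..<n}. ?s f xs i) \<oplus>\<^bsub>M\<^esub> (\<Oplus>\<^bsub>M\<^esub>i\<in>{..<n}. ?s f' xs i)"
          by (rule mod.M.finsum_addf[OF cl])
        finally have sum: "(\<Oplus>\<^bsub>M\<^esub>i\<in>{..<n}. ?s (f \<otimes>\<^bsub>cochain_group G M n\<^esub> f') xs i) = \<dots>" .
        have val: "(f \<otimes>\<^bsub>cochain_group G M n\<^esub> f') ys = f ys \<oplus>\<^bsub>M\<^esub> f' ys" if "ys \<in> group_tuples G n" for ys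
          using that by (simp add: cochain_group_def)
        have scl: "(\<Oplus>\<^bsub>M\<^esub>i\<in>{..<n}. ?s f xs i) \<in> carrier M" "(\<Oplus>\<^bsub>M\<^esub>i\<in>{..<n}. ?s f' xs i) \<in> carrier M"
          using cl by (simp_all only: mod.M.finsum_closed)
        show ?thesis
          using True f t(1-3) scl
          by (simp add: coboundary_map_def sum val act_add mod.M.add.int_pow_distrib
              cochain_group_def[of G M "Suc n"] mod.M.a_ac del: power_Suc)
      qed (simp add: coboundary_map_def cochain_group_def)
    qed
  qed
qed

lemma coboundary_map_group_hom:
  "group_hom (cochain_group G M n) (cochain_group G M (Suc n)) (coboundary_map G M n)"
  using cochain_comm_group coboundary_map_hom
  by (simp add: group_hom_def group_hom_axioms_def comm_group_def)

text \<open>A zero-cochain is a function on the empty tuple alone, that is, a module element.\<close>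

lemma coboundary_map_0:
  assumes "f [] \<in> carrier M" "g \<in> carrier G"
  shows "coboundary_map G M 0 f [g] = act g (f []) \<ominus>\<^bsub>M\<^esub> f []"
  using assms mod.M.add.int_pow_neg[of "f []" 1]
  by (simp add: coboundary_map_def group_tuples_def a_minus_def)

lemma group_tuples_1: "group_tuples G 1 = (\<lambda>g. [g]) ` carrier G"
  by (auto simp: group_tuples_def length_Suc_conv)

lemma coboundaries_1:
  "coboundaries G M 1 = {f \<in> carrier (cochain_group G M 1).
     \<exists>v\<in>carrier M. \<forall>g\<in>carrier G. f [g] = act g v \<ominus>\<^bsub>M\<^esub> v}" (is "_ = ?R")
proof
  have nil: "[] \<in> group_tuples G 0" by (simp add: group_tuples_def)
  show "coboundaries G M 1 \<subseteq> ?R"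
  proof
    fix f assume "f \<in> coboundaries G M 1"
    then obtain w where w: "w \<in> carrier (cochain_group G M 0)" "f = coboundary_map G M 0 w"
      by (auto simp: coboundaries_def)
    have "w [] \<in> carrier M" using w(1) nil by (auto simp: cochain_group_def)
    moreover have "f \<in> carrier (cochain_group G M 1)"
      using hom_in_carrier[OF coboundary_map_hom w(1)] w(2) by simp
    ultimately show "f \<in> ?R" using coboundary_map_0[of w] w(2) by auto
  qed
  show "?R \<subseteq> coboundaries G M 1"
  proof
    fix f assume "f \<in> ?R"
    then obtain v where f: "f \<in> carrier (cochain_group G M 1)" and v: "v \<in> carrier M"
      "\<And>g. g \<in> carrier G \<Longrightarrow> f [g] = act g v \<ominus>\<^bsub>M\<^esub> v" by auto
    let ?w = "\<lambda>xs\<in>group_tuples G 0. v"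
    have w: "?w \<in> carrier (cochain_group G M 0)" using v by (auto simp: cochain_group_def)
    have "coboundary_map G M 0 ?w \<in> carrier (cochain_group G M 1)"
      using hom_in_carrier[OF coboundary_map_hom w] by simp
    moreover have "f xs = coboundary_map G M 0 ?w xs" if xs: "xs \<in> group_tuples G 1" for xs
    proof -
      obtain g where "g \<in> carrier G" "xs = [g]" using xs unfolding group_tuples_1 by auto
      thus ?thesis using coboundary_map_0[of ?w g] v nil by simp
    qed
    ultimately have "f = coboundary_map G M 0 ?w"
      using f unfolding cochain_group_def partial_object.simps by (metis PiE_ext)
    thus "f \<in> coboundaries G M 1" using w by (auto simp: coboundaries_def)
  qed
qed

lemma coboundaries_1_subset_cocycles: "coboundaries G M 1 \<subseteq> cocycles G M 1"
proof
  fix f assume "f \<in> coboundaries G M 1"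
  then obtain v where f: "f \<in> carrier (cochain_group G M 1)" and v: "v \<in> carrier M"
    "\<And>g. g \<in> carrier G \<Longrightarrow> f [g] = act g v \<ominus>\<^bsub>M\<^esub> v" unfolding coboundaries_1 by blast
  have "f [g \<otimes> h] = f [g] \<oplus>\<^bsub>M\<^esub> act g (f [h])" if gh: "g \<in> carrier G" "h \<in> carrier G" for g h
  proof -
    have "f [g] \<oplus>\<^bsub>M\<^esub> act g (f [h]) = (act g v \<ominus>\<^bsub>M\<^esub> v) \<oplus>\<^bsub>M\<^esub> (act g (act h v) \<ominus>\<^bsub>M\<^esub> act g v)"
      using gh v by (simp add: a_minus_def act_add act_minus)
    also have "\<dots> = act g (act h v) \<ominus>\<^bsub>M\<^esub> v"
      using gh v(1) by (simp add: a_minus_def mod.M.a_ac mod.M.r_neg1 mod.M.r_neg2)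
    finally show ?thesis using gh v by (simp add: act_mult)
  qed
  thus "f \<in> cocycles G M 1"
    using f cocycles_1_iff[OF group_axioms mod.left_module_axioms, of f] by (simp add: cochain_group_def)
qed

lemma cochain_pow:
  fixes k :: nat
  assumes "f \<in> carrier (cochain_group G M n)" "xs \<in> group_tuples G n"
  shows "(f [^]\<^bsub>cochain_group G M n\<^esub> k) xs = [int k] \<cdot>\<^bsub>M\<^esub> f xs"
proof -
  have f: "f xs \<in> carrier M" using assms by (auto simp: cochain_group_def)
  show ?thesis
  proof (induction k)
    case 0 thus ?case using assms by (simp add: cochain_group_def add_pow_def)
  next
    case (Suc k)
    have "int (Suc k) = int k + 1" by simp
    hence "[int (Suc k)] \<cdot>\<^bsub>M\<^esub> f xs = [int k] \<cdot>\<^bsub>M\<^esub> f xs \<oplus>\<^bsub>M\<^esub> f xs"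
      using f mod.M.add.int_pow_mult[of "f xs" "int k" 1] by (simp only: mod.M.add.int_pow_1)
    thus ?case using Suc assms by (simp add: cochain_group_def[of G M n] nat_pow_Suc del: of_nat_Suc)
  qed
qed

text \<open>The quotient of cocycles by coboundaries is only usable as a group once both are known to be
  subgroups of the abelian group of cochains. Then a power of a class is the class of the power, which
  is trivial if the multiple of the crossed homomorphism is principal.\<close>

lemma annihilated_H1I:
  fixes n :: nat
  assumes "\<And>f. \<lbrakk>f \<in> carrier G \<rightarrow> carrier M;
      \<And>g h. \<lbrakk>g \<in> carrier G; h \<in> carrier G\<rbrakk> \<Longrightarrow> f (g \<otimes> h) = f g \<oplus>\<^bsub>M\<^esub> act g (f h)\<rbrakk>
    \<Longrightarrow> \<exists>v\<in>carrier M. \<forall>g\<in>carrier G. [int n] \<cdot>\<^bsub>M\<^esub> f g = act g v \<ominus>\<^bsub>M\<^esub> v"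
  shows "annihilated_by (group_cohomology G M 1) n"
proof -
  let ?C = "cochain_group G M 1" and ?Z = "cocycles G M 1" and ?B = "coboundaries G M 1"
  let ?Z1 = "?C\<lparr>carrier := ?Z\<rparr>"
  interpret C: comm_group ?C by (rule cochain_comm_group)
  interpret d0: group_hom "cochain_group G M 0" ?C "coboundary_map G M 0"
    using coboundary_map_group_hom[of 0] by simp
  have Z: "subgroup ?Z ?C"
    unfolding cocycles_def by (rule group_hom.subgroup_kernel[OF coboundary_map_group_hom])
  have "subgroup ?B ?C" using d0.img_is_subgroup by (simp add: coboundaries_def)
  hence B: "subgroup ?B ?Z1" using C.subgroup_incl Z coboundaries_1_subset_cocycles by blast
  interpret Z1: comm_group ?Z1
    by (rule group.group_comm_groupI[OF subgroup.subgroup_is_group[OF Z C.group_axioms]])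
      (use Z C.m_comm in \<open>auto dest: subgroup.mem_carrier\<close>)
  interpret N: normal ?B ?Z1 by (rule Z1.subgroup_imp_normal[OF B])
  show ?thesis
    unfolding annihilated_by_def
  proof
    fix x assume "x \<in> carrier (group_cohomology G M 1)"
    then obtain z where z: "z \<in> ?Z" "x = ?B #>\<^bsub>?Z1\<^esub> z"
      by (auto simp: group_cohomology_def carrier_FactGroup)
    have zC: "z \<in> carrier ?C" using z(1) Z by (rule subgroup.mem_carrier[rotated])
    have zt: "z \<in> group_tuples G 1 \<rightarrow>\<^sub>E carrier M"
      "g \<in> carrier G \<Longrightarrow> h \<in> carrier G \<Longrightarrow> z [g \<otimes> h] = z [g] \<oplus>\<^bsub>M\<^esub> act g (z [h])" for g h
      using z(1) cocycles_1_iff[OF group_axioms mod.left_module_axioms, of z] by auto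
    have "\<exists>v\<in>carrier M. \<forall>g\<in>carrier G. [int n] \<cdot>\<^bsub>M\<^esub> z [g] = act g v \<ominus>\<^bsub>M\<^esub> v"
      by (rule assms[of "\<lambda>g. z [g]"]) (use zt in \<open>auto simp: group_tuples_1[unfolded One_nat_def]\<close>)
    moreover have "(z [^]\<^bsub>?C\<^esub> n) [g] = [int n] \<cdot>\<^bsub>M\<^esub> z [g]" if "g \<in> carrier G" for g
      by (rule cochain_pow[OF zC]) (use that in \<open>simp add: group_tuples_def\<close>)
    ultimately have zn: "z [^]\<^bsub>?C\<^esub> n \<in> ?B"
      unfolding coboundaries_1 using C.nat_pow_closed[OF zC, of n] by auto
    have "x [^]\<^bsub>?Z1 Mod ?B\<^esub> n = ?B #>\<^bsub>?Z1\<^esub> (z [^]\<^bsub>?Z1\<^esub> n)"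
      using N.FactGroup_pow[of z n] z by simp
    also have "z [^]\<^bsub>?Z1\<^esub> n = z [^]\<^bsub>?C\<^esub> n"
      using C.nat_pow_consistent by simp
    also have "?B #>\<^bsub>?Z1\<^esub> (z [^]\<^bsub>?C\<^esub> n) = ?B"
      by (rule Z1.coset_join2) (use zn B coboundaries_1_subset_cocycles in auto)
    finally show "x [^]\<^bsub>group_cohomology G M 1\<^esub> n = \<one>\<^bsub>group_cohomology G M 1\<^esub>"
      by (simp add: group_cohomology_def)
  qed
qed

end

section \<open>Multiples of crossed homomorphisms into the cokernel\<close>

text \<open>The least exponent exists because the order of the group is one.\<close>

lemma (in group) pow_group_exponent:
  assumes "finite (carrier G)" "x \<in> carrier G"
  shows "x [^] group_exponent G = \<one>"
proof -
  have "0 < order G \<and> (\<forall>x\<in>carrier G. x [^] order G = \<one>)"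
    using assms(1) by (simp add: order_gt_0_iff_finite pow_order_eq_1)
  from LeastI[of "\<lambda>n. 0 < n \<and> (\<forall>x\<in>carrier G. x [^] n = \<one>)", OF this]
  show ?thesis using assms(2) by (simp add: group_exponent_def)
qed

text \<open>The classical reason why the group order annihilates cohomology: summing the cocycle rule
  over \<open>h\<close>, both \<open>f h\<close> and \<open>f (g \<otimes> h)\<close> range over all values of \<open>f\<close>.\<close>

lemma (in group_ring_module) crossed_hom_sum:
  assumes fin: "finite (carrier G)" and f: "f \<in> carrier G \<rightarrow> carrier M"
    and crossed: "\<And>g h. \<lbrakk>g \<in> carrier G; h \<in> carrier G\<rbrakk> \<Longrightarrow> f (g \<otimes> h) = f g \<oplus>\<^bsub>M\<^esub> act g (f h)"
    and g: "g \<in> carrier G"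
  shows "(\<Oplus>\<^bsub>M\<^esub>h\<in>carrier G. f h) = [int (order G)] \<cdot>\<^bsub>M\<^esub> f g \<oplus>\<^bsub>M\<^esub> act g (\<Oplus>\<^bsub>M\<^esub>h\<in>carrier G. f h)"
proof -
  have "(\<Oplus>\<^bsub>M\<^esub>h\<in>carrier G. f h) = (\<Oplus>\<^bsub>M\<^esub>h\<in>(\<lambda>h. g \<otimes> h) ` carrier G. f h)"
    using g by (simp add: surj_const_mult)
  also have "\<dots> = (\<Oplus>\<^bsub>M\<^esub>h\<in>carrier G. f (g \<otimes> h))"
    by (rule mod.M.finsum_reindex) (use f g in \<open>auto simp: inj_on_cmult\<close>)
  also have "\<dots> = (\<Oplus>\<^bsub>M\<^esub>h\<in>carrier G. f g \<oplus>\<^bsub>M\<^esub> act g (f h))"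
    by (rule mod.M.finsum_cong') (use f g crossed in \<open>auto simp: Pi_iff\<close>)
  also have "\<dots> = (\<Oplus>\<^bsub>M\<^esub>h\<in>carrier G. f g) \<oplus>\<^bsub>M\<^esub> (\<Oplus>\<^bsub>M\<^esub>h\<in>carrier G. act g (f h))"
    by (rule mod.M.finsum_addf) (use f g in \<open>auto simp: Pi_iff\<close>)
  also have "(\<Oplus>\<^bsub>M\<^esub>h\<in>carrier G. f g) = [order G] \<cdot>\<^bsub>M\<^esub> f g"
    using mod.M.add.finprod_const[of "f g" "carrier G"] f g by (auto simp: order_def)
  also have "[order G] \<cdot>\<^bsub>M\<^esub> f g = [int (order G)] \<cdot>\<^bsub>M\<^esub> f g"
    by (simp add: add_pow_def int_pow_int)
  also have "(\<Oplus>\<^bsub>M\<^esub>h\<in>carrier G. act g (f h)) = act g (\<Oplus>\<^bsub>M\<^esub>h\<in>carrier G. f h)"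
    by (rule act_finsum[symmetric, OF g f])
  finally show ?thesis .
qed

lemma left_module_hom_simps:
  assumes "left_module R A" "left_module R C" "h \<in> left_module_hom R A C"
  shows left_module_hom_closed: "x \<in> carrier A \<Longrightarrow> h x \<in> carrier C"
    and left_module_hom_add: "x \<in> carrier A \<Longrightarrow> y \<in> carrier A \<Longrightarrow> h (x \<oplus>\<^bsub>A\<^esub> y) = h x \<oplus>\<^bsub>C\<^esub> h y"
    and left_module_hom_diff: "x \<in> carrier A \<Longrightarrow> y \<in> carrier A \<Longrightarrow> h (x \<ominus>\<^bsub>A\<^esub> y) = h x \<ominus>\<^bsub>C\<^esub> h y"
    and left_module_hom_int_mult: "x \<in> carrier A \<Longrightarrow> h ([(k::int)] \<cdot>\<^bsub>A\<^esub> x) = [k] \<cdot>\<^bsub>C\<^esub> h x"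
proof -
  interpret A: left_module R A by fact
  interpret C: left_module R C by fact
  interpret h: group_hom "add_monoid A" "add_monoid C" h
    using assms(3) by (simp add: group_hom_def group_hom_axioms_def left_module_hom_def A.M.a_group C.M.a_group)
  show "h x \<in> carrier C" if "x \<in> carrier A" for x
    using h.hom_closed that by simp
  show add: "h (x \<oplus>\<^bsub>A\<^esub> y) = h x \<oplus>\<^bsub>C\<^esub> h y" if "x \<in> carrier A" "y \<in> carrier A" for x y
    using h.hom_mult that by simp
  show "h (x \<ominus>\<^bsub>A\<^esub> y) = h x \<ominus>\<^bsub>C\<^esub> h y" if "x \<in> carrier A" "y \<in> carrier A" for x y
    using add[of x "\<ominus>\<^bsub>A\<^esub> y"] h.hom_inv[of y] that by (simp add: a_inv_def a_minus_def)
  show "h ([k] \<cdot>\<^bsub>A\<^esub> x) = [k] \<cdot>\<^bsub>C\<^esub> h x" if "x \<in> carrier A" for x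
    using h.hom_int_pow[of x k] that by (simp add: add_pow_def)
qed

lemma (in group) left_module_hom_act:
  assumes "h \<in> left_module_hom (int_group_ring G) A C" "g \<in> carrier G" "x \<in> carrier A"
  shows "h (group_act A g x) = group_act C g (h x)"
  using assms group_ring_of_closed by (simp add: left_module_hom_def group_act_def)

text \<open>This improves the annihilator from the group order \<open>N\<close> to the exponent: the relation
  \<open>N f(g) = y - g y\<close> is lifted to \<open>F\<close>, multiplied by \<open>n\<close>, and there divided by \<open>N\<close>. The division is
  possible in \<open>F\<close> because of the integer coordinates, which \<open>M\<close> need not have.\<close>

lemma crossed_hom_times_exponent_principal:
  fixes G :: "('g, 'r) monoid_scheme" (structure)
  assumes "group G" and fin: "finite (carrier G)" and "left_module (int_group_ring G) M"
    and "permutation_presentation G F i p M"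
    and exponent: "\<And>g. g \<in> carrier G \<Longrightarrow> g [^] n = \<one>"
    and f: "f \<in> carrier G \<rightarrow> carrier M"
    and crossed: "\<And>g h. \<lbrakk>g \<in> carrier G; h \<in> carrier G\<rbrakk> \<Longrightarrow> f (g \<otimes> h) = f g \<oplus>\<^bsub>M\<^esub> group_act M g (f h)"
  shows "\<exists>v\<in>carrier M. \<forall>g\<in>carrier G. [int n] \<cdot>\<^bsub>M\<^esub> f g = group_act M g v \<ominus>\<^bsub>M\<^esub> v"
proof -
  interpret group G by fact
  interpret M: group_ring_module G M using assms by (simp add: group_ring_module_def)
  obtain B where F: "left_module (int_group_ring G) F" and B: "is_int_basis F B"
    "\<And>g. g \<in> carrier G \<Longrightarrow> bij_betw (group_act F g) B B"
    and i: "i \<in> left_module_hom (int_group_ring G) F F" and p: "p \<in> left_module_hom (int_group_ring G) F M"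
    and inj: "inj_on i (carrier F)" and ex: "i ` carrier F = kernel (add_monoid F) (add_monoid M) p"
    and surj: "p ` carrier F = carrier M"
    using assms(4) unfolding permutation_presentation_def permutation_module_def left_module_short_exact_def
    by auto
  interpret F: permutation_basis G F B
    using F B by (auto simp: permutation_basis_def permutation_basis_axioms_def group_ring_module_def group_axioms)
  note i_simps = left_module_hom_simps[OF F F i] left_module_hom_act[OF i]
  note p_simps = left_module_hom_simps[OF F assms(3) p] left_module_hom_act[OF p]
  have lift: "\<exists>x\<in>carrier F. i x = y" if "y \<in> carrier F" "p y = \<zero>\<^bsub>M\<^esub>" for y
  proof -
    have "y \<in> i ` carrier F" using that ex by (simp add: kernel_def)
    thus ?thesis by blast
  qed
  have pi: "p (i x) = \<zero>\<^bsub>M\<^esub>" if "x \<in> carrier F" for x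
    using that ex by (auto simp: kernel_def)
  define N where "N = int (order G)"
  have N: "N \<noteq> 0" using fin by (simp add: N_def order_gt_0_iff_finite[THEN iffD2])
  define y where "y = (\<Oplus>\<^bsub>M\<^esub>h\<in>carrier G. f h)"
  have y: "y \<in> carrier M" unfolding y_def by (rule M.mod.M.finsum_closed[OF f])
  have Nf: "y = [N] \<cdot>\<^bsub>M\<^esub> f g \<oplus>\<^bsub>M\<^esub> group_act M g y" if "g \<in> carrier G" for g
    unfolding y_def N_def by (rule M.crossed_hom_sum[OF fin f crossed that])
  have p_lift: "\<exists>x\<in>carrier F. p x = z" if "z \<in> carrier M" for z
    using that unfolding surj[symmetric] by blast
  obtain Y where Y: "Y \<in> carrier F" "p Y = y" using y p_lift by blast
  have "\<forall>g\<in>carrier G. \<exists>x\<in>carrier F. p x = f g" using f p_lift by (simp add: Pi_iff)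
  then obtain \<phi> where \<phi>: "\<And>g. g \<in> carrier G \<Longrightarrow> \<phi> g \<in> carrier F \<and> p (\<phi> g) = f g" by metis
  \<comment> \<open>\<open>T\<close> measures how far the relation \<open>N f(g) = y - g y\<close> is from holding for the lifts.\<close>
  define T where "T g = ([N] \<cdot>\<^bsub>F\<^esub> \<phi> g \<oplus>\<^bsub>F\<^esub> group_act F g Y) \<ominus>\<^bsub>F\<^esub> Y" for g
  have T: "T g \<in> carrier F" "p (T g) = \<zero>\<^bsub>M\<^esub>" if g: "g \<in> carrier G" for g
  proof -
    show "T g \<in> carrier F" using g \<phi> Y by (simp add: T_def)
    have "p (T g) = y \<ominus>\<^bsub>M\<^esub> y" using g \<phi> Y Nf[OF g] by (simp add: T_def p_simps)
    thus "p (T g) = \<zero>\<^bsub>M\<^esub>" using y by (simp add: a_minus_def M.mod.M.r_neg)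
  qed
  have "\<forall>g\<in>carrier G. \<exists>s\<in>carrier F. i s = T g" using T lift by blast
  then obtain S where S: "\<And>g. g \<in> carrier G \<Longrightarrow> S g \<in> carrier F \<and> i (S g) = T g" by metis
  have S_cocycle: "\<exists>c\<in>carrier F. S (g \<otimes> h) = S g \<oplus>\<^bsub>F\<^esub> group_act F g (S h) \<oplus>\<^bsub>F\<^esub> [N] \<cdot>\<^bsub>F\<^esub> c"
    if gh: "g \<in> carrier G" "h \<in> carrier G" for g h
  proof -
    \<comment> \<open>The terms in \<open>Y\<close> form a coboundary, so \<open>T\<close> violates the cocycle rule by exactly \<open>N\<close> times the
      amount \<open>D\<close> by which \<open>\<phi>\<close> does; since \<open>D\<close> maps to zero in \<open>M\<close>, it comes from some \<open>c\<close>.\<close>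
    define D where "D = \<phi> (g \<otimes> h) \<ominus>\<^bsub>F\<^esub> (\<phi> g \<oplus>\<^bsub>F\<^esub> group_act F g (\<phi> h))"
    have D: "D \<in> carrier F" using gh \<phi> by (simp add: D_def)
    have "p D = f (g \<otimes> h) \<ominus>\<^bsub>M\<^esub> f (g \<otimes> h)" using gh \<phi> by (simp add: D_def p_simps crossed)
    hence "p D = \<zero>\<^bsub>M\<^esub>" using f gh by (auto simp: a_minus_def Pi_iff M.mod.M.r_neg)
    then obtain c where c: "c \<in> carrier F" "i c = D" using lift D by blast
    have "T (g \<otimes> h) = T g \<oplus>\<^bsub>F\<^esub> group_act F g (T h) \<oplus>\<^bsub>F\<^esub> [N] \<cdot>\<^bsub>F\<^esub> D"
    proof (rule F.coord_eqI)
      fix b assume "b \<in> B"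
      thus "F.coord (T (g \<otimes> h)) b = F.coord (T g \<oplus>\<^bsub>F\<^esub> group_act F g (T h) \<oplus>\<^bsub>F\<^esub> [N] \<cdot>\<^bsub>F\<^esub> D) b"
        using gh \<phi> Y by (simp add: T_def D_def F.coord_simps inv_mult_group F.act_mult algebra_simps)
    qed (use gh T D in auto)
    also have "\<dots> = i (S g \<oplus>\<^bsub>F\<^esub> group_act F g (S h) \<oplus>\<^bsub>F\<^esub> [N] \<cdot>\<^bsub>F\<^esub> c)"
      using gh S c by (simp add: i_simps)
    finally have "i (S (g \<otimes> h)) = \<dots>" using S gh by simp
    from inj_onD[OF inj this] show ?thesis using gh S c by auto
  qed
  obtain X where X: "X \<in> carrier F" "\<And>g. g \<in> carrier G \<Longrightarrow>
      \<exists>e\<in>carrier F. [int n] \<cdot>\<^bsub>F\<^esub> S g = [N] \<cdot>\<^bsub>F\<^esub> e \<oplus>\<^bsub>F\<^esub> (X \<ominus>\<^bsub>F\<^esub> group_act F g X)"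
    by (rule F.mod_cocycle_times_exponent_splits[OF fin N exponent _ S_cocycle]) (use S in auto)
  obtain e where e: "\<And>g. g \<in> carrier G \<Longrightarrow> e g \<in> carrier F \<and>
      [int n] \<cdot>\<^bsub>F\<^esub> S g = [N] \<cdot>\<^bsub>F\<^esub> e g \<oplus>\<^bsub>F\<^esub> (X \<ominus>\<^bsub>F\<^esub> group_act F g X)"
    using X(2) by metis
  \<comment> \<open>Multiplying the definition of \<open>T\<close> by \<open>n\<close> and applying \<open>i\<close> to the splitting of \<open>n S(g)\<close> gives two
    expressions for \<open>n T(g)\<close>; collecting the principal terms on one side leads to \<open>W\<close>.\<close>
  define W where "W = i X \<oplus>\<^bsub>F\<^esub> [int n] \<cdot>\<^bsub>F\<^esub> Y"
  define d where "d g = [int n] \<cdot>\<^bsub>F\<^esub> \<phi> g \<ominus>\<^bsub>F\<^esub> i (e g)" for g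
  have iX: "i X \<in> carrier F" using X(1) i_simps(1) by blast
  have W: "W \<in> carrier F" using iX Y by (simp add: W_def)
  have d: "d g \<in> carrier F \<and> W \<ominus>\<^bsub>F\<^esub> group_act F g W = [N] \<cdot>\<^bsub>F\<^esub> d g" if g: "g \<in> carrier G" for g
  proof
    have ie: "i (e g) \<in> carrier F" using e g i_simps(1) by blast
    show dc: "d g \<in> carrier F" using \<phi> g ie by (simp add: d_def)
    have nT: "[int n] \<cdot>\<^bsub>F\<^esub> T g = [N] \<cdot>\<^bsub>F\<^esub> i (e g) \<oplus>\<^bsub>F\<^esub> (i X \<ominus>\<^bsub>F\<^esub> group_act F g (i X))"
    proof -
      have "[int n] \<cdot>\<^bsub>F\<^esub> T g = i ([int n] \<cdot>\<^bsub>F\<^esub> S g)" using S g by (simp add: i_simps)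
      also have "\<dots> = i ([N] \<cdot>\<^bsub>F\<^esub> e g \<oplus>\<^bsub>F\<^esub> (X \<ominus>\<^bsub>F\<^esub> group_act F g X))" using e g by simp
      also have "\<dots> = [N] \<cdot>\<^bsub>F\<^esub> i (e g) \<oplus>\<^bsub>F\<^esub> (i X \<ominus>\<^bsub>F\<^esub> group_act F g (i X))"
        using e g X(1) by (simp add: i_simps)
      finally show ?thesis .
    qed
    show "W \<ominus>\<^bsub>F\<^esub> group_act F g W = [N] \<cdot>\<^bsub>F\<^esub> d g"
    proof (rule F.coord_eqI)
      fix b assume b: "b \<in> B"
      have "F.coord ([int n] \<cdot>\<^bsub>F\<^esub> T g) b
          = F.coord ([N] \<cdot>\<^bsub>F\<^esub> i (e g) \<oplus>\<^bsub>F\<^esub> (i X \<ominus>\<^bsub>F\<^esub> group_act F g (i X))) b" using nT by simp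
      thus "F.coord (W \<ominus>\<^bsub>F\<^esub> group_act F g W) b = F.coord ([N] \<cdot>\<^bsub>F\<^esub> d g) b"
        using b g ie iX Y(1) \<phi> by (simp add: T_def W_def d_def F.coord_simps algebra_simps)
    qed (use W g dc in auto)
  qed
  obtain U where U: "U \<in> carrier F" "\<And>g. g \<in> carrier G \<Longrightarrow> d g = U \<ominus>\<^bsub>F\<^esub> group_act F g U"
    by (rule F.principal_divided[OF N W d]) auto
  have pU: "p U \<in> carrier M" using U(1) p_simps(1) by blast
  show ?thesis
  proof (intro bexI ballI)
    fix g assume g: "g \<in> carrier G"
    have fg: "f g \<in> carrier M" using f g by auto
    have "p (d g) = [int n] \<cdot>\<^bsub>M\<^esub> f g \<ominus>\<^bsub>M\<^esub> \<zero>\<^bsub>M\<^esub>"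
      using g \<phi> e by (simp add: d_def p_simps i_simps pi)
    hence "[int n] \<cdot>\<^bsub>M\<^esub> f g = p (d g)" using fg by (simp add: a_minus_def)
    also have "\<dots> = p U \<ominus>\<^bsub>M\<^esub> group_act M g (p U)" using U g by (simp add: p_simps)
    also have "\<dots> = group_act M g (\<ominus>\<^bsub>M\<^esub> p U) \<ominus>\<^bsub>M\<^esub> (\<ominus>\<^bsub>M\<^esub> p U)"
      using pU g by (simp add: a_minus_def M.act_minus M.mod.M.a_comm)
    finally show "[int n] \<cdot>\<^bsub>M\<^esub> f g = group_act M g (\<ominus>\<^bsub>M\<^esub> p U) \<ominus>\<^bsub>M\<^esub> (\<ominus>\<^bsub>M\<^esub> p U)" .
  qed (use pU in simp)
qed

theorem proposition2p5:
  fixes \<Gamma> :: "('g, 'r) monoid_scheme"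
    and M :: "('g \<Rightarrow> int, 'm, 'k) module_scheme"
    and F :: "('g \<Rightarrow> int, 'f, 'l) module_scheme"
    and i :: "'f \<Rightarrow> 'f" and p :: "'f \<Rightarrow> 'm"
  assumes "group \<Gamma>" and "finite (carrier \<Gamma>)"
    and "left_module (int_group_ring \<Gamma>) M"
    and "permutation_presentation \<Gamma> F i p M"
  shows "annihilated_by (group_cohomology \<Gamma> M 1) (group_exponent \<Gamma>)"
proof -
  interpret M: group_ring_module \<Gamma> M using assms(1,3) by (simp add: group_ring_module_def)
  show ?thesis
    by (rule M.annihilated_H1I,
        rule crossed_hom_times_exponent_principal[OF assms M.pow_group_exponent[OF assms(2)]])
qed

end
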